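(* Let $K$ be a non-compact locally compact hypergroup with a left Haar measure and let $\sigma$ be a non-degenerate probability measure on $K$. Then $H_\sigma(K)=\{0\}$.
   Context: $K$ is a locally compact hypergroup (Jewett/Bloom–Heyer sense), assumed to have a left Haar measure, with measure algebra $(M(K),* )$. For $\sigma\in M(K)$, $H_\sigma(K)=\{\mu\in M(K):\sigma*\mu=\mu\}$. For subsets $A,B\subseteq K$, $A*B=\bigcup_{a\in A,b\in B}\operatorname{supp}(\delta_a*\delta_b)$ and $A^n$ is the $n$-fold product. A measure $\mu\in M(K)$ is non-degenerate if $K=\overline{\bigcup_{n\geq1}(\operatorname{supp}|\mu|)^n}$. *)

theory Defs
  imports "HOL-Analysis.Analysis" "HOL-Probability.Probability"
begin

definition radon :: "'a::topological_space measure \<Rightarrow> bool" where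
  "radon m \<longleftrightarrow> sets m = sets borel
     \<and> (\<forall>C. compact C \<longrightarrow> emeasure m C < \<infinity>)
     \<and> (\<forall>A \<in> sets borel. emeasure m A = (INF U \<in> {U. open U \<and> A \<subseteq> U}. emeasure m U))
     \<and> (\<forall>U. open U \<longrightarrow> emeasure m U = (SUP C \<in> {C. compact C \<and> C \<subseteq> U}. emeasure m C))"

definition fin_radon :: "'a::topological_space measure \<Rightarrow> bool" where
  "fin_radon m \<longleftrightarrow> radon m \<and> finite_measure m"

definition msupp :: "'a::topological_space measure \<Rightarrow> 'a set" where
  "msupp m = {x. \<forall>U. open U \<and> x \<in> U \<longrightarrow> emeasure m U \<noteq> 0}"

definition Cc :: "('a::topological_space \<Rightarrow> real) set" where
  "Cc = {f. continuous_on UNIV f \<and> compact (closure {x. f x \<noteq> 0})}"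

text \<open>A bounded complex Radon measure is represented by its values on Borel sets
  (value 0 on non-Borel sets); it is of the form (m1 - m2) + i (m3 - m4) with
  finite positive Radon measures m1..m4 (Jordan decomposition).\<close>
definition cdecomp ::
  "('a::topological_space set \<Rightarrow> complex) \<Rightarrow> 'a measure \<Rightarrow> 'a measure \<Rightarrow> 'a measure \<Rightarrow> 'a measure \<Rightarrow> bool" where
  "cdecomp \<nu> m1 m2 m3 m4 \<longleftrightarrow> fin_radon m1 \<and> fin_radon m2 \<and> fin_radon m3 \<and> fin_radon m4
     \<and> (\<forall>A. \<nu> A = (if A \<in> sets borel
            then complex_of_real (measure m1 A - measure m2 A)
                 + \<i> * complex_of_real (measure m3 A - measure m4 A)
            else 0))"

definition Mmeas :: "('a::topological_space set \<Rightarrow> complex) set" where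
  "Mmeas = {\<nu>. \<exists>m1 m2 m3 m4. cdecomp \<nu> m1 m2 m3 m4}"

text \<open>Integral of a bounded Borel function against a complex measure
  (independent of the chosen decomposition).\<close>
definition cint :: "('a::topological_space set \<Rightarrow> complex) \<Rightarrow> ('a \<Rightarrow> real) \<Rightarrow> complex" where
  "cint \<nu> f = (let (m1, m2, m3, m4) = (SOME (m1, m2, m3, m4). cdecomp \<nu> m1 m2 m3 m4) in
      complex_of_real ((\<integral>x. f x \<partial>m1) - (\<integral>x. f x \<partial>m2))
      + \<i> * complex_of_real ((\<integral>x. f x \<partial>m3) - (\<integral>x. f x \<partial>m4)))"

section \<open>Hypergroups (Jewett / Bloom--Heyer), via convolution of point masses\<close>

text \<open>conv x y is the probability measure \<delta>_x * \<delta>_y; e is the identity, inv the involution.\<close>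

definition hypergroup :: "('a::t2_space \<Rightarrow> 'a \<Rightarrow> 'a measure) \<Rightarrow> 'a \<Rightarrow> ('a \<Rightarrow> 'a) \<Rightarrow> bool" where
  "hypergroup conv e iv \<longleftrightarrow>
     locally_compact_space (euclidean :: 'a topology)
     \<comment> \<open>\<delta>_x * \<delta>_y is a probability Radon measure with compact support\<close>
   \<and> (\<forall>x y. prob_space (conv x y) \<and> fin_radon (conv x y) \<and> compact (msupp (conv x y)))
     \<comment> \<open>associativity: (\<delta>_x * \<delta>_y) * \<delta>_z = \<delta>_x * (\<delta>_y * \<delta>_z)\<close>
   \<and> (\<forall>x y z. \<forall>A \<in> sets borel.
        (\<integral>w. measure (conv w z) A \<partial>conv x y) = (\<integral>w. measure (conv x w) A \<partial>conv y z))
     \<comment> \<open>weak continuity of (x,y) \<mapsto> \<delta>_x * \<delta>_y\<close>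
   \<and> (\<forall>f \<in> Cc. continuous_on UNIV (\<lambda>p. \<integral>t. f t \<partial>conv (fst p) (snd p)))
     \<comment> \<open>continuity of (x,y) \<mapsto> supp(\<delta>_x * \<delta>_y) in the Michael topology\<close>
   \<and> (\<forall>U. open U \<longrightarrow> open {p. msupp (conv (fst p) (snd p)) \<subseteq> U}
                    \<and> open {p. msupp (conv (fst p) (snd p)) \<inter> U \<noteq> {}})
     \<comment> \<open>identity\<close>
   \<and> (\<forall>x. conv e x = return borel x \<and> conv x e = return borel x)
     \<comment> \<open>involution\<close>
   \<and> homeomorphism UNIV UNIV iv iv
   \<and> (\<forall>x. iv (iv x) = x)
   \<and> (\<forall>x y. distr (conv x y) borel iv = conv (iv y) (iv x))
   \<and> (\<forall>x y. e \<in> msupp (conv x y) \<longleftrightarrow> x = iv y)"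

definition left_haar :: "('a::t2_space \<Rightarrow> 'a \<Rightarrow> 'a measure) \<Rightarrow> 'a measure \<Rightarrow> bool" where
  "left_haar conv m \<longleftrightarrow> radon m \<and> emeasure m UNIV \<noteq> 0
     \<and> (\<forall>x. \<forall>f \<in> Cc. (\<forall>t. f t \<ge> 0) \<longrightarrow>
          (\<integral>\<^sup>+y. ennreal (\<integral>t. f t \<partial>conv x y) \<partial>m) = (\<integral>\<^sup>+t. ennreal (f t) \<partial>m))"

definition hset_prod :: "('a::topological_space \<Rightarrow> 'a \<Rightarrow> 'a measure) \<Rightarrow> 'a set \<Rightarrow> 'a set \<Rightarrow> 'a set" where
  "hset_prod conv A B = (\<Union>a\<in>A. \<Union>b\<in>B. msupp (conv a b))"

text \<open>A^n; A^0 = {e}, so A^1 = {e} * A = A.\<close>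
primrec hset_pow :: "('a::topological_space \<Rightarrow> 'a \<Rightarrow> 'a measure) \<Rightarrow> 'a \<Rightarrow> 'a set \<Rightarrow> nat \<Rightarrow> 'a set" where
  "hset_pow conv e A 0 = {e}"
| "hset_pow conv e A (Suc n) = hset_prod conv (hset_pow conv e A n) A"

text \<open>Non-degeneracy of a positive measure \<sigma> (here |\<sigma>| = \<sigma>).\<close>
definition nondegenerate :: "('a::topological_space \<Rightarrow> 'a \<Rightarrow> 'a measure) \<Rightarrow> 'a \<Rightarrow> 'a measure \<Rightarrow> bool" where
  "nondegenerate conv e \<sigma> \<longleftrightarrow> closure (\<Union>n\<in>{1..}. hset_pow conv e (msupp \<sigma>) n) = UNIV"

definition conv_pm :: "('a::topological_space \<Rightarrow> 'a \<Rightarrow> 'a measure) \<Rightarrow> 'a measure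
     \<Rightarrow> ('a set \<Rightarrow> complex) \<Rightarrow> ('a set \<Rightarrow> complex)" where
  "conv_pm conv \<sigma> \<mu> = (\<lambda>A. if A \<in> sets borel
      then cint \<mu> (\<lambda>y. \<integral>x. measure (conv x y) A \<partial>\<sigma>) else 0)"

definition H_sigma :: "('a::topological_space \<Rightarrow> 'a \<Rightarrow> 'a measure) \<Rightarrow> 'a measure \<Rightarrow> ('a set \<Rightarrow> complex) set" where
  "H_sigma conv \<sigma> = {\<mu> \<in> Mmeas. conv_pm conv \<sigma> \<mu> = \<mu>}"

end

theory Submission
  imports Defs
begin

text \<open>Let \<open>\<sigma> * \<mu> = \<mu>\<close>. For \<open>f \<in> C\<^sub>c\<close> the function \<open>F(x) = \<integral> f d(\<delta>\<^sub>x * \<mu>)\<close> is continuous, vanishes at infinity and,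
  by associativity, satisfies \<open>F(x) = \<integral> F d(\<delta>\<^sub>x * \<sigma>)\<close>. If \<open>F\<close> had a positive maximum, attained at
  \<open>x\<^sub>0\<close>, then \<open>F\<close> would be maximal on \<open>supp (\<delta>\<^bsub>x\<^sub>0\<^esub> * \<delta>\<^sub>t)\<close> for all \<open>t\<close> in the powers of \<open>supp \<sigma>\<close>, hence for all
  \<open>t\<close> by non-degeneracy and semicontinuity. Taking \<open>t\<close> to be the involute of \<open>x\<^sub>0\<close> shows that \<open>F\<close> is maximal
  at \<open>e\<close>; repeating the argument at \<open>e\<close>, where \<open>\<delta>\<^sub>e * \<delta>\<^sub>t = \<delta>\<^sub>t\<close>, shows that \<open>F\<close> is a positive constant.
  This is impossible for a function vanishing at infinity on a non-compact space. So \<open>F = 0\<close>, and \<open>F(e) = 0\<close> for all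
  \<open>f\<close> gives \<open>\<mu> = 0\<close>.\<close>

section \<open>Radon and tight measures\<close>

text \<open>Tightness is inherited by the mixtures \<open>\<sigma> \<bind> conv x\<close>, and it is
  enough for parameter integrals and Fubini; for these measures it replaces the full Radon
  property.\<close>

definition tight_measure :: "'a::topological_space measure \<Rightarrow> bool" where
  "tight_measure M \<longleftrightarrow> finite_measure M \<and> sets M = sets borel
     \<and> (\<forall>\<epsilon>>0. \<exists>C. compact C \<and> measure M (- C) < \<epsilon>)"

lemma fin_radonD:
  assumes "fin_radon M"
  shows "sets M = sets borel" "space M = UNIV" "finite_measure M"
  using assms sets_eq_imp_space_eq[of M borel] by (auto simp: fin_radon_def radon_def)

lemma fin_radon_open_compact:
  fixes M :: "'a::t2_space measure"
  assumes M: "fin_radon M" and U: "open U" and t: "t < measure M U"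
  obtains C where "compact C" "C \<subseteq> U" "t < measure M C"
proof (cases "t < 0")
  case True
  then show ?thesis using that[of "{}"] by simp
next
  case False
  interpret finite_measure M using fin_radonD(3)[OF M] .
  have "ennreal t < emeasure M U"
    using t False by (simp add: emeasure_eq_measure ennreal_less_iff)
  also have "emeasure M U = (SUP C \<in> {C. compact C \<and> C \<subseteq> U}. emeasure M C)"
    using M U by (auto simp: fin_radon_def radon_def)
  finally obtain C where "compact C" "C \<subseteq> U" "ennreal t < emeasure M C"
    by (auto simp: less_SUP_iff)
  with False show ?thesis
    by (intro that[of C]) (auto simp: emeasure_eq_measure ennreal_less_iff)
qed

lemma fin_radon_imp_tight:
  fixes M :: "'a::t2_space measure"
  assumes M: "fin_radon M"
  shows "tight_measure M"
  unfolding tight_measure_def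
proof (intro conjI allI impI)
  interpret finite_measure M using fin_radonD(3)[OF M] .
  show "finite_measure M" "sets M = sets borel" using fin_radonD[OF M] by auto
  fix \<epsilon> :: real assume "\<epsilon> > 0"
  then obtain C where C: "compact C" "measure M UNIV - \<epsilon> < measure M C"
    using fin_radon_open_compact[OF M open_UNIV, of "measure M UNIV - \<epsilon>"] by auto
  have "measure M (- C) = measure M UNIV - measure M C"
    using C(1) fin_radonD[OF M] finite_measure_compl[of C]
    by (simp add: Compl_eq_Diff_UNIV compact_imp_closed)
  with C show "\<exists>C. compact C \<and> measure M (- C) < \<epsilon>"
    by (intro exI[of _ C]) simp
qed

section \<open>Supports and lower semicontinuous functions\<close>

lemma fin_radon_open_null:
  fixes M :: "'a::t2_space measure"
  assumes M: "fin_radon M" and U: "open U" and disj: "msupp M \<inter> U = {}"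
  shows "measure M U = 0"
proof (rule ccontr)
  interpret finite_measure M using fin_radonD(3)[OF M] .
  assume "measure M U \<noteq> 0"
  then have "0 < measure M U" by (simp add: zero_less_measure_iff)
  then obtain C where C: "compact C" "C \<subseteq> U" "0 < measure M C"
    using fin_radon_open_compact[OF M U] by metis
  \<comment> \<open>Compactness of \<open>C\<close> stands in for a countable base: finitely many
    null open sets will cover it.\<close>
  have "\<exists>V. open V \<and> x \<in> V \<and> emeasure M V = 0" if "x \<in> C" for x
  proof -
    have "x \<notin> msupp M" using that C(2) disj by blast
    then show ?thesis unfolding msupp_def by blast
  qed
  then obtain V where V: "\<And>x. x \<in> C \<Longrightarrow> open (V x) \<and> x \<in> V x \<and> emeasure M (V x) = 0"
    by metis
  obtain D where D: "D \<subseteq> C" "finite D" "C \<subseteq> (\<Union>x\<in>D. V x)"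
    using compactE_image[OF C(1), of C V] V by (metis (no_types, lifting) UN_I subsetI)
  have "(\<Union>x\<in>D. V x) \<in> null_sets M"
    using D V fin_radonD(1)[OF M]
    by (intro null_sets_UN' countable_finite) (auto simp: null_sets_def subset_iff)
  then have "C \<in> null_sets M"
    using D(3) C(1) fin_radonD(1)[OF M] by (auto intro: null_sets_subset simp: compact_imp_closed)
  with C(3) show False by (simp add: measure_eq_0_null_sets)
qed

lemma msupp_open_pos:
  fixes M :: "'a::topological_space measure"
  assumes "finite_measure M" "open U" "x \<in> U" "x \<in> msupp M"
  shows "0 < measure M U"
  using assms finite_measure.emeasure_eq_measure[OF assms(1), of U]
  by (auto simp: msupp_def zero_less_measure_iff)

lemma closed_msupp: "closed (msupp M)"
proof -
  have "- msupp M = \<Union>{U. open U \<and> emeasure M U = 0}"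
    by (auto simp: msupp_def)
  then show ?thesis by (simp add: closed_def open_Union)
qed

lemma lsc_borel_measurable:
  fixes \<phi> :: "'a::topological_space \<Rightarrow> real"
  assumes "\<And>t. open {x. t < \<phi> x}"
  shows "\<phi> \<in> borel_measurable borel"
  using assms by (auto simp: borel_measurable_iff_greater)

text \<open>The function vanishes almost everywhere, so the set where it is positive is null; being
  open, it cannot meet the support. This upgrades almost-everywhere statements to every point of the
  support.\<close>

lemma lsc_zero_on_msupp:
  fixes \<phi> :: "'a::topological_space \<Rightarrow> real"
  assumes M: "finite_measure M" "sets M = sets borel"
    and lsc: "\<And>t. open {x. t < \<phi> x}" and bd: "\<And>x. 0 \<le> \<phi> x" "\<And>x. \<phi> x \<le> 1"
    and int0: "(\<integral>x. \<phi> x \<partial>M) = 0" and x: "x \<in> msupp M"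
  shows "\<phi> x = 0"
proof (rule ccontr)
  interpret finite_measure M by fact
  assume "\<phi> x \<noteq> 0"
  then have "x \<in> {x. 0 < \<phi> x}" using bd(1)[of x] by simp
  then have pos: "0 < measure M {x. 0 < \<phi> x}"
    by (rule msupp_open_pos[OF M(1) lsc _ x])
  have meas[measurable]: "\<phi> \<in> borel_measurable M"
    using lsc_borel_measurable[OF lsc] M(2) by (simp cong: measurable_cong_sets)
  have "integrable M \<phi>"
    by (rule integrable_const_bound[where B=1]) (use bd in auto)
  then have "AE x in M. \<phi> x = 0"
    using int0 bd by (subst (asm) integral_nonneg_eq_0_iff_AE) auto
  then have "AE x in M. x \<notin> {x. 0 < \<phi> x}" by eventually_elim auto
  then have "measure M {x. 0 < \<phi> x} = 0"
    using lsc[of 0] M(2) by (subst (asm) AE_iff_measurable[of "{x. 0 < \<phi> x}"])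
      (auto simp: measure_def sets_eq_imp_space_eq[OF M(2)])
  with pos show False by simp
qed

text \<open>For a finite Radon measure the complement of the support is null, so values off the
  support do not affect the integral.\<close>

lemma integral_zero_on_msupp:
  fixes \<phi> :: "'a::t2_space \<Rightarrow> real"
  assumes M: "fin_radon M" and "\<And>x. x \<in> msupp M \<Longrightarrow> \<phi> x = 0"
  shows "(\<integral>x. \<phi> x \<partial>M) = 0"
proof -
  interpret finite_measure M using fin_radonD(3)[OF M] .
  have "measure M (- msupp M) = 0"
    using fin_radon_open_null[OF M, of "- msupp M"] closed_msupp[of M] by auto
  then have "- msupp M \<in> null_sets M"
    using closed_msupp[of M] fin_radonD(1)[OF M]
    by (auto simp: null_sets_def emeasure_eq_measure)
  then have "AE x in M. \<phi> x = 0"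
    by (rule AE_I') (use assms(2) in auto)
  then show ?thesis by (rule integral_eq_zero_AE)
qed

section \<open>Compactly supported test functions and uniqueness of Radon measures\<close>

lemma Hausdorff_space_euclidean_t2: "Hausdorff_space (euclidean :: 'a::t2_space topology)"
  unfolding Hausdorff_space_def disjnt_def using hausdorff by (metis open_openin)

lemma Urysohn_Cc:
  fixes C U :: "'a::t2_space set"
  assumes lc: "locally_compact_space (euclidean :: 'a topology)"
    and C: "compact C" and U: "open U" and CU: "C \<subseteq> U"
  obtains f where "f \<in> Cc" "\<And>x. 0 \<le> f x" "\<And>x. f x \<le> 1" "\<And>x. x \<in> C \<Longrightarrow> f x = 1" "\<And>x. x \<notin> U \<Longrightarrow> f x = 0"
proof -
  have "\<exists>V L. open V \<and> compact L \<and> C \<subseteq> V \<and> V \<subseteq> L"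
    using lc[unfolded locally_compact_space_compact_closed_compact[OF disjI1[OF Hausdorff_space_euclidean_t2]]] C
    by (metis compactin_euclidean_iff open_openin)
  then obtain V L where V: "open V" "compact L" "C \<subseteq> V" "V \<subseteq> L" by blast
  have "completely_regular_space (euclidean :: 'a topology)"
    using lc Hausdorff_space_euclidean_t2
    by (intro locally_compact_regular_imp_completely_regular_space) auto
  \<comment> \<open>Cutting \<open>U\<close> down to \<open>U \<inter> V\<close> makes
    \<open>f\<close> vanish outside the compact set \<open>L\<close>, so that its support is
    compact.\<close>
  moreover have "closedin euclidean (- (U \<inter> V))" using U V by auto
  moreover have "disjnt C (- (U \<inter> V))" using V CU by (auto simp: disjnt_def)
  ultimately obtain f where f: "continuous_map euclidean (top_of_set {0..1::real}) f"
      "f ` (- (U \<inter> V)) \<subseteq> {0}" "f ` C \<subseteq> {1}"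
    using Urysohn_completely_regular_compact_closed[of 0 1 euclidean C] C
    by (metis compactin_euclidean_iff zero_le_one)
  have "{x. f x \<noteq> 0} \<subseteq> L" using f(2) V by blast
  then have "closure {x. f x \<noteq> 0} \<subseteq> L"
    using V(2) by (simp add: closure_minimal compact_imp_closed)
  then have "compact (closure {x. f x \<noteq> 0})"
    using V(2) compact_Int_closed[OF V(2) closed_closure] by (metis inf.absorb_iff2)
  moreover have "continuous_on UNIV f" "\<And>x. f x \<in> {0..1}"
    using f(1) by (auto simp: continuous_map_in_subtopology)
  ultimately show ?thesis
    using f(2,3) by (intro that[of f]) (auto simp: Cc_def)
qed

lemma CcD:
  fixes f :: "'a::t2_space \<Rightarrow> real"
  assumes "f \<in> Cc"
  shows "continuous_on UNIV f" "\<exists>B. \<forall>x. \<bar>f x\<bar> \<le> B"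
proof -
  show c: "continuous_on UNIV f" using assms by (simp add: Cc_def)
  let ?S = "closure {x. f x \<noteq> 0}"
  have "compact (f ` ?S)"
    using assms by (intro compact_continuous_image continuous_on_subset[OF c]) (auto simp: Cc_def)
  then obtain B where B: "\<And>x. x \<in> ?S \<Longrightarrow> \<bar>f x\<bar> \<le> B"
    by (meson bounded_real compact_imp_bounded imageI)
  have "\<bar>f x\<bar> \<le> max B 0" for x
    using B[of x] closure_subset[of "{x. f x \<noteq> 0}"] by (cases "f x = 0") (auto simp: le_max_iff_disj)
  then show "\<exists>B. \<forall>x. \<bar>f x\<bar> \<le> B" by blast
qed

text \<open>This is uniqueness in the Riesz representation theorem. Urysohn functions squeezed
  between a compact and an open set compare the measures on open sets, and outer regularity carries
  the equality to Borel sets.\<close>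

lemma fin_radon_eqI:
  fixes p q :: "'a::t2_space measure"
  assumes lc: "locally_compact_space (euclidean :: 'a topology)"
    and p: "fin_radon p" and q: "fin_radon q"
    and eq: "\<And>f. f \<in> Cc \<Longrightarrow> (\<integral>x. f x \<partial>p) = (\<integral>x. f x \<partial>q)"
  shows "p = q"
proof -
  have le: "measure p U \<le> measure q U"
    if p: "fin_radon p" and q: "fin_radon q" and U: "open U"
      and eq: "\<And>f. f \<in> Cc \<Longrightarrow> (\<integral>x. f x \<partial>p) = (\<integral>x. f x \<partial>q)" for p q :: "'a measure" and U
  proof (rule ccontr)
    interpret p: finite_measure p using fin_radonD(3)[OF p] .
    interpret q: finite_measure q using fin_radonD(3)[OF q] .
    note sp = fin_radonD(1)[OF p] and sq = fin_radonD(1)[OF q]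
    assume "\<not> measure p U \<le> measure q U"
    then obtain C where C: "compact C" "C \<subseteq> U" "measure q U < measure p C"
      using fin_radon_open_compact[OF p U, of "measure q U"] by auto
    obtain f where f: "f \<in> Cc" "\<And>x. 0 \<le> f x" "\<And>x. f x \<le> 1" "\<And>x. x \<in> C \<Longrightarrow> f x = 1" "\<And>x. x \<notin> U \<Longrightarrow> f x = 0"
      using Urysohn_Cc[OF lc C(1) U C(2)] by metis
    have fb: "f \<in> borel_measurable borel" using CcD(1)[OF f(1)] by (rule borel_measurable_continuous_onI)
    have ip: "integrable p f" using fb f(2,3) sp
      by (intro p.integrable_const_bound[where B=1]) (auto cong: measurable_cong_sets)
    have iq: "integrable q f" using fb f(2,3) sq
      by (intro q.integrable_const_bound[where B=1]) (auto cong: measurable_cong_sets)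
    have "measure p C = (\<integral>x. indicator C x \<partial>p)"
      using fin_radonD(2)[OF p] by simp
    also have "\<dots> \<le> (\<integral>x. f x \<partial>p)"
      using f C(1) sp ip by (intro integral_mono) (auto split: split_indicator simp: compact_imp_closed p.emeasure_finite less_top[symmetric])
    also have "\<dots> = (\<integral>x. f x \<partial>q)" using eq f(1) by simp
    also have "\<dots> \<le> (\<integral>x. indicator U x \<partial>q)"
      using f U sq iq by (intro integral_mono) (auto split: split_indicator simp: q.emeasure_finite less_top[symmetric])
    also have "\<dots> = measure q U"
      using fin_radonD(2)[OF q] by simp
    finally show False using C(3) by simp
  qed
  interpret p: finite_measure p using fin_radonD(3)[OF p] .
  interpret q: finite_measure q using fin_radonD(3)[OF q] .
  have op: "emeasure p U = emeasure q U" if "open U" for U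
    using le[OF p q that eq] le[OF q p that eq[symmetric]]
    by (simp add: p.emeasure_eq_measure q.emeasure_eq_measure)
  show "p = q"
  proof (rule measure_eqI)
    show "sets p = sets q" using fin_radonD(1)[OF p] fin_radonD(1)[OF q] by simp
    fix A assume "A \<in> sets p"
    then have "A \<in> sets borel" using fin_radonD(1)[OF p] by simp
    then show "emeasure p A = emeasure q A"
      using p q op unfolding fin_radon_def radon_def by (auto intro!: INF_cong)
  qed
qed

section \<open>Integrals depending on a parameter\<close>

lemma continuous_on_UNIV_metricI:
  fixes f :: "'a::topological_space \<Rightarrow> 'b::metric_space"
  assumes "\<And>x \<epsilon>. 0 < \<epsilon> \<Longrightarrow> \<exists>X. open X \<and> x \<in> X \<and> (\<forall>y\<in>X. dist (f y) (f x) < \<epsilon>)"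
  shows "continuous_on UNIV f"
  unfolding continuous_on_def
proof (intro ballI tendstoI)
  fix x :: 'a and \<epsilon> :: real assume "0 < \<epsilon>"
  then show "\<forall>\<^sub>F y in at x. dist (f y) (f x) < \<epsilon>"
    using assms[of \<epsilon> x] by (auto simp: eventually_at_topological)
qed

lemma continuous_sections:
  fixes h :: "'a::topological_space \<times> 'b::topological_space \<Rightarrow> real"
  assumes "continuous_on UNIV h"
  shows "continuous_on UNIV (\<lambda>y. h (x, y))" "continuous_on UNIV (\<lambda>x. h (x, y))"
  by (rule continuous_on_compose2[OF assms]; auto intro!: continuous_intros)+

lemma bounded_continuous_integrable:
  fixes f :: "'a::topological_space \<Rightarrow> real"
  assumes "finite_measure M" "sets M = sets borel" "continuous_on UNIV f" "\<And>x. \<bar>f x\<bar> \<le> B"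
  shows "integrable M f"
  using assms borel_measurable_continuous_onI[OF assms(3)]
  by (intro finite_measure.integrable_const_bound[where B=B]) (auto cong: measurable_cong_sets)

lemma bounded_integral_bound:
  fixes f :: "'a \<Rightarrow> real"
  assumes "finite_measure M" "\<And>x. \<bar>f x\<bar> \<le> B"
  shows "\<bar>\<integral>x. f x \<partial>M\<bar> \<le> B * measure M (space M)"
proof (cases "integrable M f")
  case True
  interpret finite_measure M by fact
  have "\<bar>\<integral>x. f x \<partial>M\<bar> \<le> (\<integral>x. \<bar>f x\<bar> \<partial>M)" by (rule integral_abs_bound)
  also have "\<dots> \<le> (\<integral>x. B \<partial>M)" using True assms(2) by (intro integral_mono) auto
  finally show ?thesis by (simp add: mult.commute)
next
  case False
  \<comment> \<open>The integral of a non-integrable function is 0, so only nonnegativity of the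
    bound remains to be seen.\<close>
  have "0 \<le> B" using assms(2)[of undefined] by linarith
  with False show ?thesis by (simp add: not_integrable_integral_eq)
qed

text \<open>A compact set \<open>C\<close> carries all but a little of the mass. On it
  \<open>h (x, y)\<close> is close to \<open>h (x0, y)\<close> uniformly in \<open>y\<close> once
  \<open>x\<close> is near \<open>x0\<close>; off it the crude bound \<open>2 * B\<close> is
  enough.\<close>

lemma tight_integral_continuous:
  fixes h :: "'b::topological_space \<times> 'a::t2_space \<Rightarrow> real"
  assumes M: "tight_measure M" and h: "continuous_on UNIV h" and B: "\<And>p. \<bar>h p\<bar> \<le> B"
  shows "continuous_on UNIV (\<lambda>x. \<integral>y. h (x, y) \<partial>M)"
proof (rule continuous_on_UNIV_metricI)
  interpret finite_measure M using M by (simp add: tight_measure_def)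
  have sM: "sets M = sets borel" using M by (simp add: tight_measure_def)
  have spM: "space M = UNIV" using sets_eq_imp_space_eq[OF sM] by simp
  have B0: "0 \<le> B" using B[of undefined] by linarith
  fix x0 :: 'b and \<epsilon> :: real assume \<epsilon>: "0 < \<epsilon>"
  define c where "c = measure M UNIV"
  have c0: "0 \<le> c" by (simp add: c_def)
  \<comment> \<open>The choices give \<open>\<delta> * c < \<epsilon> / 2\<close> and
    \<open>2 * B * \<eta> \<le> \<epsilon> / 2\<close>; adding 1 keeps the denominators
    positive.\<close>
  define \<delta> where "\<delta> = \<epsilon> / (2 * (c + 1))"
  define \<eta> where "\<eta> = \<epsilon> / (4 * (B + 1))"
  have pos: "0 < \<delta>" "0 < \<eta>" using \<epsilon> B0 c0 by (auto simp: \<delta>_def \<eta>_def)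
  obtain C where C: "compact C" "measure M (- C) < \<eta>"
    using M pos by (auto simp: tight_measure_def)
  have cC: "- C \<in> sets M" using C sM by (auto simp: compact_imp_closed)
  obtain X where X: "x0 \<in> X" "open X" "\<forall>x\<in>X \<inter> UNIV. \<forall>t\<in>C. dist (h (x, t)) (h (x0, t)) \<le> \<delta>"
    using continuous_on_prod_compactE[of UNIV C h x0 \<delta>] h C(1) pos
    by (metis UNIV_I continuous_on_subset subset_UNIV)
  have int: "integrable M (\<lambda>y. h (x, y))" for x
    using finite_measure_axioms sM continuous_sections(1)[OF h] B
    by (rule bounded_continuous_integrable)
  have "dist (\<integral>y. h (x, y) \<partial>M) (\<integral>y. h (x0, y) \<partial>M) < \<epsilon>" if x: "x \<in> X" for x
  proof -
    have "\<bar>(\<integral>y. h (x, y) \<partial>M) - (\<integral>y. h (x0, y) \<partial>M)\<bar> = \<bar>\<integral>y. h (x, y) - h (x0, y) \<partial>M\<bar>"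
      using int by simp
    also have "\<dots> \<le> (\<integral>y. \<bar>h (x, y) - h (x0, y)\<bar> \<partial>M)" by (rule integral_abs_bound)
    also have "\<dots> \<le> (\<integral>y. \<delta> + 2 * B * indicator (- C) y \<partial>M)"
    proof (rule integral_mono)
      show "integrable M (\<lambda>y. \<bar>h (x, y) - h (x0, y)\<bar>)" using int by auto
      show "integrable M (\<lambda>y. \<delta> + 2 * B * indicator (- C) y)" using cC by (auto simp: emeasure_finite less_top[symmetric])
      fix y
      have "\<bar>h (x, y) - h (x0, y)\<bar> \<le> 2 * B" using B[of "(x,y)"] B[of "(x0,y)"] by linarith
      then show "\<bar>h (x, y) - h (x0, y)\<bar> \<le> \<delta> + 2 * B * indicator (- C) y"
        using X(3) x pos by (auto simp: indicator_def dist_real_def)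
    qed
    also have "\<dots> = \<delta> * c + 2 * B * measure M (- C)"
      using cC by (simp add: spM c_def emeasure_finite less_top[symmetric])
    also have "\<dots> \<le> \<delta> * c + 2 * B * \<eta>"
      using C(2) B0 by (intro add_left_mono mult_left_mono) auto
    also have "\<dots> < \<epsilon>"
    proof -
      have "\<delta> * c = \<epsilon> / 2 * (c / (c + 1))" using c0 by (simp add: \<delta>_def field_simps)
      also have "\<dots> < \<epsilon> / 2 * 1" using c0 \<epsilon> by (intro mult_strict_left_mono) auto
      finally have 1: "\<delta> * c < \<epsilon> / 2" by simp
      have "2 * B * \<eta> = \<epsilon> / 2 * (B / (B + 1))" using B0 by (simp add: \<eta>_def field_simps)
      also have "\<dots> \<le> \<epsilon> / 2 * 1" using B0 \<epsilon> by (intro mult_left_mono) auto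
      finally show ?thesis using 1 by simp
    qed
    finally show ?thesis by (simp add: dist_real_def)
  qed
  then show "\<exists>X. open X \<and> x0 \<in> X \<and> (\<forall>x\<in>X. dist (\<integral>y. h (x, y) \<partial>M) (\<integral>y. h (x0, y) \<partial>M) < \<epsilon>)"
    using X by blast
qed

section \<open>Lower semicontinuous kernels\<close>

lemma open_section:
  assumes "open W"
  shows "open {x. (x, y) \<in> W}" "open {y. (x, y) \<in> W}"
proof -
  have "continuous_on UNIV (\<lambda>x. (x, y))" "continuous_on UNIV (\<lambda>y. (x, y))"
    by (auto intro!: continuous_intros)
  then have "open ((\<lambda>x. (x, y)) -` W)" "open ((\<lambda>y. (x, y)) -` W)"
    using assms by (auto intro: open_vimage)
  then show "open {x. (x, y) \<in> W}" "open {y. (x, y) \<in> W}" by (simp_all add: vimage_def)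
qed

text \<open>Inner regularity puts a compact \<open>C\<close> of measure above \<open>t\<close>
  inside the section at \<open>y0\<close>; by the tube lemma the sections at nearby points contain
  \<open>C\<close> too.\<close>

lemma lsc_measure_section:
  fixes M :: "'a::t2_space measure" and W :: "('b::topological_space \<times> 'a) set"
  assumes M: "fin_radon M" and W: "open W"
  shows "open {y. t < measure M {x. (y, x) \<in> W}}"
proof (subst open_subopen, clarify)
  interpret finite_measure M using fin_radonD(3)[OF M] .
  fix y0 assume "t < measure M {x. (y0, x) \<in> W}"
  then obtain C where C: "compact C" "C \<subseteq> {x. (y0, x) \<in> W}" "t < measure M C"
    using fin_radon_open_compact[OF M open_section(2)[OF W]] by metis
  have "{y0} \<times> C \<subseteq> W" using C(2) by auto
  then obtain X where X: "y0 \<in> X" "open X" "X \<times> C \<subseteq> W"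
    using Elementary_Topology.tube_lemma[OF C(1) W] by blast
  have "t < measure M {x. (y, x) \<in> W}" if "y \<in> X" for y
  proof -
    have "measure M C \<le> measure M {x. (y, x) \<in> W}"
      using X(3) that open_section(2)[OF W] fin_radonD(1)[OF M]
      by (intro finite_measure_mono) auto
    with C(3) show ?thesis by simp
  qed
  then show "\<exists>T. open T \<and> y0 \<in> T \<and> T \<subseteq> {y. t < measure M {x. (y, x) \<in> W}}"
    using X by blast
qed

text \<open>The sum counts the \<open>j\<close> with \<open>j < n * u\<close>, so the quotient is
  \<open>u\<close> rounded up to a multiple of \<open>1 / n\<close>. The inequality is strict
  because strict superlevel sets of lower semicontinuous functions are open.\<close>

lemma staircase_approx:
  fixes u :: real
  assumes "0 \<le> u" "u \<le> 1" "0 < n"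
  shows "\<bar>u - (\<Sum>j<n. of_bool (real j / real n < u)) / real n\<bar> \<le> 1 / real n"
proof -
  define k where "k = nat \<lceil>real n * u\<rceil>"
  have nu: "0 \<le> real n * u" "real n * u \<le> real n" using assms by (auto simp: mult_left_le)
  have k: "real n * u \<le> real k" "real k < real n * u + 1"
    using nu unfolding k_def by linarith+
  have kn: "k \<le> n" using nu unfolding k_def by linarith
  have "real j / real n < u \<longleftrightarrow> j < k" for j
  proof -
    have "real j / real n < u \<longleftrightarrow> real j < real n * u" using assms by (simp add: field_simps)
    also have "\<dots> \<longleftrightarrow> j < k" using k by linarith
    finally show ?thesis .
  qed
  then have "(\<Sum>j<n. of_bool (real j / real n < u)) = (\<Sum>j<n. of_bool (j < k) :: real)" by simp
  also have "\<dots> = real (card ({..<n} \<inter> {j. j < k}))" by (simp add: sum_of_bool_eq)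
  also have "{..<n} \<inter> {j. j < k} = {..<k}" using kn by auto
  finally have eq: "(\<Sum>j<n. of_bool (real j / real n < u)) = real k" by simp
  have "u - real k / real n = (real n * u - real k) / real n" using assms by (simp add: field_simps)
  then have "\<bar>u - real k / real n\<bar> = \<bar>real n * u - real k\<bar> / real n" using assms by simp
  also have "\<dots> \<le> 1 / real n" using k by (intro divide_right_mono) auto
  finally show ?thesis unfolding eq .
qed

text \<open>The integrals of a lower semicontinuous kernel are uniform limits of Riemann sums of the
  measures of its superlevel sets, and those are lower semicontinuous. Joint measurability with
  respect to the product sigma-algebra is not available, as the space need not be second countable.\<close>

lemma lsc_integral_measurable:
  fixes M :: "'a::t2_space measure" and \<phi> :: "'b::topological_space \<Rightarrow> 'a \<Rightarrow> real"
  assumes M: "fin_radon M" and lsc: "\<And>t. open {p. t < \<phi> (fst p) (snd p)}"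
    and bd: "\<And>y x. 0 \<le> \<phi> y x" "\<And>y x. \<phi> y x \<le> 1"
  shows "(\<lambda>y. \<integral>x. \<phi> y x \<partial>M) \<in> borel_measurable borel"
proof -
  interpret finite_measure M using fin_radonD(3)[OF M] .
  note sM = fin_radonD(1)[OF M]
  have sec: "open {x. t < \<phi> y x}" for t y
    using open_section(2)[OF lsc[of t], of y] by simp
  have meas: "\<phi> y \<in> borel_measurable M" for y
    using lsc_borel_measurable[OF sec] sM by (simp cong: measurable_cong_sets)
  have int: "integrable M (\<phi> y)" for y
    by (rule integrable_const_bound[where B=1]) (use bd meas in auto)
  define R where "R n y = (\<Sum>j<n. measure M {x. real j / real n < \<phi> y x}) / real n" for n y
  have Rint: "R n y = (\<integral>x. (\<Sum>j<n. of_bool (real j / real n < \<phi> y x)) / real n \<partial>M)"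
    and intR: "integrable M (\<lambda>x. (\<Sum>j<n. of_bool (real j / real n < \<phi> y x)) / real n)" for n y
  proof -
    have i: "integrable M (indicator {x. real j / real n < \<phi> y x} :: _ \<Rightarrow> real)" for j
      using sec sM by (auto simp: emeasure_finite less_top[symmetric])
    have o: "of_bool (real j / real n < \<phi> y x) = (indicator {x. real j / real n < \<phi> y x} x :: real)" for j x
      by (simp add: indicator_def)
    show "integrable M (\<lambda>x. (\<Sum>j<n. of_bool (real j / real n < \<phi> y x)) / real n)"
      unfolding o using i by auto
    show "R n y = (\<integral>x. (\<Sum>j<n. of_bool (real j / real n < \<phi> y x)) / real n \<partial>M)"
      unfolding o R_def using i by (simp add: fin_radonD(2)[OF M])
  qed
  have Rmeas: "R n \<in> borel_measurable borel" for n
  proof -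
    have "(\<lambda>y. measure M {x. real j / real n < \<phi> y x}) \<in> borel_measurable borel" for j
      using lsc_measure_section[OF M lsc[of "real j / real n"]]
      by (intro lsc_borel_measurable) simp
    then show ?thesis unfolding R_def by measurable
  qed
  have "(\<lambda>n. R n y) \<longlonglongrightarrow> (\<integral>x. \<phi> y x \<partial>M)" for y
  proof (rule LIMSEQ_I)
    fix r :: real assume r: "0 < r"
    define c where "c = measure M UNIV"
    have c0: "0 \<le> c" by (simp add: c_def)
    \<comment> \<open>For such \<open>n\<close> the staircase error \<open>1 / n\<close> times the
      total mass \<open>c\<close> is below \<open>r\<close>; asking for \<open>n0 + 1\<close> also
      makes \<open>n\<close> positive.\<close>
    obtain n0 where n0: "c / r < real n0" using reals_Archimedean2 by blast
    have "norm (R n y - (\<integral>x. \<phi> y x \<partial>M)) < r" if "n \<ge> n0 + 1" for n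
    proof -
      have n: "0 < n" using that by simp
      have "\<bar>R n y - (\<integral>x. \<phi> y x \<partial>M)\<bar> = \<bar>\<integral>x. \<phi> y x - (\<Sum>j<n. of_bool (real j / real n < \<phi> y x)) / real n \<partial>M\<bar>"
        unfolding Rint using int intR by (simp add: abs_minus_commute)
      also have "\<dots> \<le> 1 / real n * measure M (space M)"
        using finite_measure_axioms staircase_approx[OF bd n] by (rule bounded_integral_bound)
      also have "\<dots> = c / real n" by (simp add: c_def fin_radonD(2)[OF M])
      also have "\<dots> < r"
      proof -
        have "c < r * real n0" using n0 r by (simp add: field_simps)
        also have "\<dots> \<le> r * real n" using that r by simp
        finally show ?thesis using n by (simp add: field_simps)
      qed
      finally show ?thesis by simp
    qed
    then show "\<exists>no. \<forall>n\<ge>no. norm (R n y - (\<integral>x. \<phi> y x \<partial>M)) < r" by blast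
  qed
  then show ?thesis by (intro borel_measurable_LIMSEQ_real[OF _ Rmeas]) auto
qed

section \<open>A Fubini theorem for continuous functions and tight measures\<close>

text \<open>Continuity alone does not settle this, since the Borel sets of the product space may
  form a larger sigma-algebra than \<open>borel \<Otimes>\<^sub>M borel\<close>. On a compact
  rectangle, however, \<open>h\<close> is a uniform limit of functions that depend only on the
  second coordinate over each of finitely many pieces of the first factor.\<close>

lemma continuous_compact_rectangle_measurable:
  fixes h :: "'a::t2_space \<times> 'b::t2_space \<Rightarrow> real"
  assumes h: "continuous_on UNIV h" and C: "compact C" and D: "compact D"
  shows "(\<lambda>p. h p * indicator C (fst p) * indicator D (snd p)) \<in> borel_measurable (borel \<Otimes>\<^sub>M borel)"
proof -
  have approx: "\<exists>g. g \<in> borel_measurable (borel \<Otimes>\<^sub>M borel) \<and>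
      (\<forall>x\<in>C. \<forall>y\<in>D. \<bar>g (x, y) - h (x, y)\<bar> \<le> \<epsilon>)" if \<epsilon>: "0 < \<epsilon>" for \<epsilon> :: real
  proof -
    have "\<exists>X. open X \<and> x \<in> X \<and> (\<forall>x'\<in>X. \<forall>y\<in>D. \<bar>h (x, y) - h (x', y)\<bar> \<le> \<epsilon>)" for x
    proof -
      obtain X where "x \<in> X" "open X" "\<forall>x'\<in>X \<inter> UNIV. \<forall>t\<in>D. dist (h (x', t)) (h (x, t)) \<le> \<epsilon>"
        using continuous_on_prod_compactE[of UNIV D h x \<epsilon>] h D \<epsilon>
        by (metis UNIV_I continuous_on_subset subset_UNIV)
      then show ?thesis by (intro exI[of _ X]) (auto simp: dist_real_def abs_minus_commute)
    qed
    then obtain X where X: "\<And>x. open (X x)" "\<And>x. x \<in> X x"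
        "\<And>x x' y. x' \<in> X x \<Longrightarrow> y \<in> D \<Longrightarrow> \<bar>h (x, y) - h (x', y)\<bar> \<le> \<epsilon>"
      by metis
    obtain F where F: "finite F" "C \<subseteq> (\<Union>x\<in>F. X x)"
      using compactE_image[OF C, of C X] X by (metis (no_types, lifting) UN_I subsetI)
    \<comment> \<open>The approximation is built patch by patch: over \<open>X a\<close> it is
      overwritten by the section of \<open>h\<close> at \<open>a\<close>.\<close>
    have "\<exists>g. g \<in> borel_measurable (borel \<Otimes>\<^sub>M borel) \<and>
        (\<forall>x\<in>(\<Union>x\<in>F. X x). \<forall>y\<in>D. \<bar>g (x, y) - h (x, y)\<bar> \<le> \<epsilon>)"
      using F(1)
    proof induction
      case empty
      show ?case by (intro exI[of _ "\<lambda>_. 0"]) auto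
    next
      case (insert a F)
      then obtain g where g[measurable]: "g \<in> borel_measurable (borel \<Otimes>\<^sub>M borel)"
        and ga: "\<And>x y. x \<in> (\<Union>x\<in>F. X x) \<Longrightarrow> y \<in> D \<Longrightarrow> \<bar>g (x, y) - h (x, y)\<bar> \<le> \<epsilon>" by blast
      have [measurable]: "X a \<in> sets borel" using X(1) by auto
      have [measurable]: "(\<lambda>y. h (a, y)) \<in> borel_measurable borel"
        using continuous_sections(1)[OF h] by (rule borel_measurable_continuous_onI)
      let ?g = "\<lambda>p. if fst p \<in> X a then h (a, snd p) else g p"
      have "?g \<in> borel_measurable (borel \<Otimes>\<^sub>M borel)" by measurable
      moreover have "\<bar>?g (x, y) - h (x, y)\<bar> \<le> \<epsilon>" if "x \<in> (\<Union>x\<in>insert a F. X x)" "y \<in> D" for x y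
        using that X(3)[of x a y] ga[of x y] by auto
      ultimately show ?case by blast
    qed
    with F(2) show ?thesis by blast
  qed
  have "\<forall>n. \<exists>g. g \<in> borel_measurable (borel \<Otimes>\<^sub>M borel) \<and>
      (\<forall>x\<in>C. \<forall>y\<in>D. \<bar>g (x, y) - h (x, y)\<bar> \<le> 1 / real (Suc n))"
    using approx by simp
  then obtain g where g[measurable]: "\<And>n. g n \<in> borel_measurable (borel \<Otimes>\<^sub>M borel)"
    and ga: "\<And>n x y. x \<in> C \<Longrightarrow> y \<in> D \<Longrightarrow> \<bar>g n (x, y) - h (x, y)\<bar> \<le> 1 / real (Suc n)" by metis
  have [measurable]: "C \<in> sets borel" "D \<in> sets borel"
    using C D by (auto simp: compact_imp_closed)
  show ?thesis
  proof (rule borel_measurable_LIMSEQ_real)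
    show "(\<lambda>p. g n p * indicator C (fst p) * indicator D (snd p)) \<in> borel_measurable (borel \<Otimes>\<^sub>M borel)" for n
      by measurable
    fix p :: "'a \<times> 'b"
    show "(\<lambda>n. g n p * indicator C (fst p) * indicator D (snd p)) \<longlonglongrightarrow> h p * indicator C (fst p) * indicator D (snd p)"
    proof (cases "fst p \<in> C \<and> snd p \<in> D")
      case True
      have "(\<lambda>n. g n p) \<longlonglongrightarrow> h p"
      proof (rule Lim_transform_bound[where g="\<lambda>n. 1 / real (Suc n)", THEN Lim_null[THEN iffD2]])
        show "\<forall>\<^sub>F n in sequentially. norm (g n p - h p) \<le> norm (1 / real (Suc n))"
          using ga[of "fst p" "snd p"] True by (auto simp del: of_nat_Suc)
        show "(\<lambda>n. 1 / real (Suc n)) \<longlonglongrightarrow> 0" by (rule lim_inverse_n'[THEN LIMSEQ_Suc])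
      qed
      with True show ?thesis by simp
    next
      case False
      then show ?thesis by (auto simp: indicator_def)
    qed
  qed
qed

text \<open>Compact sets missing less than \<open>1 / (n + 1)\<close> of the mass have a union with
  null complement. These unions are the carriers on which Fubini is applied.\<close>

lemma tight_sigma_compact:
  fixes M :: "'a::t2_space measure"
  assumes M: "tight_measure M"
  shows "\<exists>C :: nat \<Rightarrow> 'a set. (\<forall>n. compact (C n)) \<and> (AE x in M. x \<in> (\<Union>n. C n))"
proof -
  interpret finite_measure M using M by (simp add: tight_measure_def)
  have sM: "sets M = sets borel" using M by (simp add: tight_measure_def)
  have "\<forall>n. \<exists>C. compact C \<and> measure M (- C) < 1 / real (Suc n)"
    using M by (simp add: tight_measure_def)
  then obtain C where C: "\<And>n. compact (C n)" "\<And>n. measure M (- C n) < 1 / real (Suc n)" by metis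
  have Cs: "C n \<in> sets M" for n using C(1) sM by (auto simp: compact_imp_closed)
  have Ns: "- (\<Union>n. C n) \<in> sets M" using Cs sets.compl_sets[of "\<Union>n. C n" M] sets_eq_imp_space_eq[OF sM]
    by (auto simp: Compl_eq_Diff_UNIV)
  have le: "measure M (- (\<Union>n. C n)) \<le> 1 / real (Suc n)" for n
  proof -
    have "measure M (- (\<Union>n. C n)) \<le> measure M (- C n)"
      using C(1)[of n] sM by (intro finite_measure_mono) (auto simp: compact_imp_closed)
    with C(2)[of n] show ?thesis by linarith
  qed
  have "(\<lambda>n. 1 / real (Suc n)) \<longlonglongrightarrow> 0" by (rule lim_inverse_n'[THEN LIMSEQ_Suc])
  then have "measure M (- (\<Union>n. C n)) \<le> 0"
    by (rule LIMSEQ_le_const) (use le in auto)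
  then have "- (\<Union>n. C n) \<in> null_sets M"
    using Ns by (simp add: null_sets_def emeasure_eq_measure measure_le_0_iff)
  then have "AE x in M. x \<in> (\<Union>n. C n)" by (rule AE_I') auto
  with C(1) show ?thesis by (intro exI[of _ C] conjI allI)
qed

text \<open>Classical Fubini applies after cutting \<open>h\<close> down to a product of two
  sigma-compact sets of full measure, where it is product measurable. The cut changes the inner and
  outer integrands only on null sets.\<close>

lemma Fubini_continuous_tight:
  fixes h :: "'a::t2_space \<times> 'b::t2_space \<Rightarrow> real"
  assumes M: "tight_measure M" and N: "tight_measure N"
    and h: "continuous_on UNIV h" and B: "\<And>p. \<bar>h p\<bar> \<le> B"
  shows "(\<integral>x. (\<integral>y. h (x, y) \<partial>N) \<partial>M) = (\<integral>y. (\<integral>x. h (x, y) \<partial>M) \<partial>N)"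
proof -
  interpret M: finite_measure M using M by (simp add: tight_measure_def)
  interpret N: finite_measure N using N by (simp add: tight_measure_def)
  interpret P: pair_sigma_finite M N ..
  interpret P: finite_measure "M \<Otimes>\<^sub>M N" by (rule finite_measure_pair_measure) unfold_locales
  have sM[measurable_cong]: "sets M = sets borel" and sN[measurable_cong]: "sets N = sets borel"
    using M N by (auto simp: tight_measure_def)
  obtain C :: "nat \<Rightarrow> 'a set" where C: "\<forall>n. compact (C n)" "AE x in M. x \<in> (\<Union>n. C n)"
    using tight_sigma_compact[OF M] by blast
  obtain D :: "nat \<Rightarrow> 'b set" where D: "\<forall>n. compact (D n)" "AE x in N. x \<in> (\<Union>n. D n)"
    using tight_sigma_compact[OF N] by blast
  have B0: "0 \<le> B" using B[of undefined] by linarith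
  define k where "k x y = h (x, y) * indicator (\<Union>n. C n) x * indicator (\<Union>n. D n) y" for x y
  have kb: "\<bar>k x y\<bar> \<le> B" for x y
    using B[of "(x,y)"] B0 by (auto simp: k_def indicator_def)
  have hsec[measurable]: "(\<lambda>y. h (x, y)) \<in> borel_measurable borel" "(\<lambda>x. h (x, y)) \<in> borel_measurable borel" for x y
    using continuous_sections[OF h] by (auto intro: borel_measurable_continuous_onI)
  have h': "continuous_on UNIV (\<lambda>p. h (snd p, fst p))"
    by (rule continuous_on_compose2[OF h]) (auto intro!: continuous_intros)
  have iM[measurable]: "(\<lambda>x. \<integral>y. h (x, y) \<partial>N) \<in> borel_measurable borel"
    using tight_integral_continuous[OF N h B] by (rule borel_measurable_continuous_onI)
  have iN[measurable]: "(\<lambda>y. \<integral>x. h (x, y) \<partial>M) \<in> borel_measurable borel"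
    using tight_integral_continuous[OF M h', of B] B by (auto intro: borel_measurable_continuous_onI)
  have kp: "case_prod k \<in> borel_measurable (M \<Otimes>\<^sub>M N)"
  proof -
    \<comment> \<open>Finite unions of the compact sets are compact, so each partial cut-off is
      measurable; the full one is their pointwise limit.\<close>
    have "(\<lambda>p. h p * indicator (\<Union>n. C n) (fst p) * indicator (\<Union>n. D n) (snd p)) \<in> borel_measurable (borel \<Otimes>\<^sub>M borel)"
    proof (rule borel_measurable_LIMSEQ_real)
      show "(\<lambda>p. h p * indicator (\<Union>i<n. C i) (fst p) * indicator (\<Union>i<n. D i) (snd p)) \<in> borel_measurable (borel \<Otimes>\<^sub>M borel)" for n
        using C(1) D(1) by (intro continuous_compact_rectangle_measurable h compact_UN) auto
      show "(\<lambda>n. h p * indicator (\<Union>i<n. C i) (fst p) * indicator (\<Union>i<n. D i) (snd p)) \<longlonglongrightarrow>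
          h p * indicator (\<Union>n. C n) (fst p) * indicator (\<Union>n. D n) (snd p)" for p
        by (intro tendsto_mult tendsto_const LIMSEQ_indicator_UN)
    qed
    also have "(\<lambda>p. h p * indicator (\<Union>n. C n) (fst p) * indicator (\<Union>n. D n) (snd p)) = case_prod k"
      by (auto simp: k_def)
    finally show ?thesis
      using sets_pair_measure_cong[OF sM sN] by (simp cong: measurable_cong_sets)
  qed
  have ki: "integrable (M \<Otimes>\<^sub>M N) (case_prod k)"
    using kp kb by (intro P.integrable_const_bound[where B=B]) auto
  have "(\<integral>x. (\<integral>y. h (x, y) \<partial>N) \<partial>M) = (\<integral>x. (\<integral>y. k x y \<partial>N) \<partial>M)"
  proof (rule integral_cong_AE)
    show "(\<lambda>x. \<integral>y. h (x, y) \<partial>N) \<in> borel_measurable M" by measurable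
    show "(\<lambda>x. \<integral>y. k x y \<partial>N) \<in> borel_measurable M"
      using kp by (rule N.borel_measurable_lebesgue_integral)
    show "AE x in M. (\<integral>y. h (x, y) \<partial>N) = (\<integral>y. k x y \<partial>N)"
      using C(2)
    proof eventually_elim
      case (elim x)
      show ?case
      proof (rule integral_cong_AE)
        show "k x \<in> borel_measurable N"
          using measurable_compose_Pair1[OF _ kp, of x] sets_eq_imp_space_eq[OF sM] by simp
        show "AE y in N. h (x, y) = k x y"
          using D(2) by eventually_elim (use elim in \<open>simp add: k_def\<close>)
      qed measurable
    qed
  qed
  also have "\<dots> = (\<integral>y. (\<integral>x. k x y \<partial>M) \<partial>N)"
    using P.Fubini_integral[OF ki] by simp
  also have "\<dots> = (\<integral>y. (\<integral>x. h (x, y) \<partial>M) \<partial>N)"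
  proof (rule integral_cong_AE)
    show "(\<lambda>y. \<integral>x. h (x, y) \<partial>M) \<in> borel_measurable N" by measurable
    have "(\<lambda>(y, x). k x y) \<in> borel_measurable (N \<Otimes>\<^sub>M M)"
      using measurable_pair_swap[OF kp] by (simp add: case_prod_beta')
    then show "(\<lambda>y. \<integral>x. k x y \<partial>M) \<in> borel_measurable N"
      by (rule M.borel_measurable_lebesgue_integral)
    show "AE y in N. (\<integral>x. k x y \<partial>M) = (\<integral>x. h (x, y) \<partial>M)"
      using D(2)
    proof eventually_elim
      case (elim y)
      show ?case
      proof (rule integral_cong_AE)
        show "(\<lambda>x. k x y) \<in> borel_measurable M"
          using measurable_compose[OF measurable_Pair2'[of y N M] kp] sets_eq_imp_space_eq[OF sN] by simp
        show "AE x in M. k x y = h (x, y)"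
          using C(2) by eventually_elim (use elim in \<open>simp add: k_def\<close>)
      qed measurable
    qed
  qed
  finally show ?thesis .
qed

text \<open>The four-measure form replaces an identity between signed measures.\<close>

lemma integral_add_eq_of_measure_add_eq:
  fixes f :: "'a::topological_space \<Rightarrow> real"
  assumes fin: "finite_measure a" "finite_measure b" "finite_measure c" "finite_measure d"
    and sets: "sets a = sets borel" "sets b = sets borel" "sets c = sets borel" "sets d = sets borel"
    and eq: "\<And>A. A \<in> sets borel \<Longrightarrow> measure a A + measure b A = measure c A + measure d A"
    and f: "continuous_on UNIV f" and B: "\<And>x. \<bar>f x\<bar> \<le> B"
  shows "(\<integral>x. f x \<partial>a) + (\<integral>x. f x \<partial>b) = (\<integral>x. f x \<partial>c) + (\<integral>x. f x \<partial>d)"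
proof -
  interpret a: finite_measure a by fact
  interpret b: finite_measure b by fact
  interpret c: finite_measure c by fact
  interpret d: finite_measure d by fact

  have fm: "f \<in> borel_measurable borel" using f by (rule borel_measurable_continuous_onI)
  \<comment> \<open>With no subtraction in the identity, the standard induction over nonnegative
    Borel functions runs in \<open>ennreal\<close>, with monotone convergence for the limit
    step.\<close>
  have nn: "(\<integral>\<^sup>+x. g x \<partial>a) + (\<integral>\<^sup>+x. g x \<partial>b) = (\<integral>\<^sup>+x. g x \<partial>c) + (\<integral>\<^sup>+x. g x \<partial>d)"
    if "g \<in> borel_measurable borel" for g :: "'a \<Rightarrow> ennreal"
    using that
  proof (induction rule: borel_measurable_induct)
    case (cong f g)
    then show ?case by simp
  next
    case (set A)
    then have "ennreal (measure a A + measure b A) = ennreal (measure c A + measure d A)" using eq by simp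
    with set show ?case
      by (simp add: sets a.emeasure_eq_measure b.emeasure_eq_measure c.emeasure_eq_measure d.emeasure_eq_measure
          flip: ennreal_plus)
  next
    case (mult u k)
    have "(\<integral>\<^sup>+x. k * u x \<partial>m) = k * (\<integral>\<^sup>+x. u x \<partial>m)" if "sets m = sets borel" for m :: "'a measure"
      using mult that by (intro nn_integral_cmult) (simp cong: measurable_cong_sets)
    with mult show ?case by (simp add: sets flip: distrib_left)
  next
    case (add u v)
    have "(\<integral>\<^sup>+x. v x + u x \<partial>m) = (\<integral>\<^sup>+x. v x \<partial>m) + (\<integral>\<^sup>+x. u x \<partial>m)" if "sets m = sets borel" for m :: "'a measure"
      using add that by (intro nn_integral_add) (simp_all cong: measurable_cong_sets)
    note e = this[OF sets(1)] this[OF sets(2)] this[OF sets(3)] this[OF sets(4)]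
    show ?case unfolding e using add.IH by (metis (no_types, lifting) add.assoc add.commute)
  next
    case (seq U)
    have s: "(\<integral>\<^sup>+x. (SUP i. U i) x \<partial>m) = (SUP i. \<integral>\<^sup>+x. U i x \<partial>m)" if "sets m = sets borel" for m :: "'a measure"
      using seq that by (simp add: nn_integral_monotone_convergence_SUP image_comp cong: measurable_cong_sets)
    have inc: "incseq (\<lambda>i. \<integral>\<^sup>+x. U i x \<partial>m)" for m :: "'a measure"
      using seq by (auto simp: incseq_def le_fun_def intro!: nn_integral_mono)
    have e: "(\<integral>\<^sup>+x. (SUP i. U i) x \<partial>m) + (\<integral>\<^sup>+x. (SUP i. U i) x \<partial>m') = (SUP i. (\<integral>\<^sup>+x. U i x \<partial>m) + (\<integral>\<^sup>+x. U i x \<partial>m'))"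
      if "sets m = sets borel" "sets m' = sets borel" for m m' :: "'a measure"
      unfolding s[OF that(1)] s[OF that(2)] by (rule ennreal_SUP_add[OF inc inc, symmetric])
    show ?case
      using e[OF sets(1,2)] e[OF sets(3,4)] seq.IH by simp
  qed
  have B0: "0 \<le> B" using B[of undefined] by linarith
  \<comment> \<open>Adding \<open>B\<close> makes \<open>f\<close> nonnegative; the extra terms
    cancel at the end by \<open>eq\<close> at \<open>UNIV\<close>.\<close>
  have i: "(\<integral>\<^sup>+x. ennreal (f x + B) \<partial>m) = ennreal ((\<integral>x. f x \<partial>m) + B * measure m UNIV)"
      "0 \<le> (\<integral>x. f x \<partial>m) + B * measure m UNIV"
    if m: "finite_measure m" "sets m = sets borel" for m
  proof -
    interpret finite_measure m by fact
    have "space m = UNIV" using sets_eq_imp_space_eq[OF m(2)] by simp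
    moreover have fi: "integrable m f" using m f B by (rule bounded_continuous_integrable)
    ultimately have I: "(\<integral>x. f x + B \<partial>m) = (\<integral>x. f x \<partial>m) + B * measure m UNIV" by simp
    have nonneg: "0 \<le> f x + B" for x using B[of x] by linarith
    show "(\<integral>\<^sup>+x. ennreal (f x + B) \<partial>m) = ennreal ((\<integral>x. f x \<partial>m) + B * measure m UNIV)"
      unfolding I[symmetric] using fi nonneg by (intro nn_integral_eq_integral) auto
    show "0 \<le> (\<integral>x. f x \<partial>m) + B * measure m UNIV"
      unfolding I[symmetric] using nonneg by simp
  qed
  have "(\<integral>\<^sup>+x. ennreal (f x + B) \<partial>a) + (\<integral>\<^sup>+x. ennreal (f x + B) \<partial>b) =
      (\<integral>\<^sup>+x. ennreal (f x + B) \<partial>c) + (\<integral>\<^sup>+x. ennreal (f x + B) \<partial>d)"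
    using fm by (intro nn) auto
  then have "(\<integral>x. f x \<partial>a) + B * measure a UNIV + ((\<integral>x. f x \<partial>b) + B * measure b UNIV) =
     (\<integral>x. f x \<partial>c) + B * measure c UNIV + ((\<integral>x. f x \<partial>d) + B * measure d UNIV)"
    using i(2)[OF fin(1) sets(1)] i(2)[OF fin(2) sets(2)] i(2)[OF fin(3) sets(3)] i(2)[OF fin(4) sets(4)]
    unfolding i(1)[OF fin(1) sets(1)] i(1)[OF fin(2) sets(2)] i(1)[OF fin(3) sets(3)] i(1)[OF fin(4) sets(4)]
    by (simp flip: ennreal_plus)
  moreover have "B * measure a UNIV + B * measure b UNIV = B * measure c UNIV + B * measure d UNIV"
    using eq[of UNIV] by (simp flip: distrib_left)
  ultimately show ?thesis by linarith
qed

section \<open>Kernels and supports in a hypergroup\<close>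

text \<open>Open sets form an intersection-stable generator, so measurability need only be checked
  on the sets where lower semicontinuity will provide it.\<close>

lemma prob_kernelI:
  fixes K :: "'b::topological_space \<Rightarrow> 'a::topological_space measure"
  assumes "\<And>x. prob_space (K x)" "\<And>x. sets (K x) = sets borel"
    and "\<And>U. open U \<Longrightarrow> (\<lambda>x. measure (K x) U) \<in> borel_measurable borel"
  shows "K \<in> measurable borel (subprob_algebra borel)"
proof (rule measurable_subprob_algebra_generated[where \<Omega>=UNIV and G="{U. open U}"])
  show "sets borel = sigma_sets UNIV {U :: 'a set. open U}" by (simp add: borel_def)
  show "Int_stable {U :: 'a set. open U}" by (auto simp: Int_stable_def)
  show "subprob_space (K x)" for x using assms(1) by (rule prob_space_imp_subprob_space)
  show "sets (K x) = sets borel" for x by fact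
  have *: "emeasure (K x) U = ennreal (measure (K x) U)" for x U
    using assms(1) by (simp add: prob_space.finite_measure finite_measure.emeasure_eq_measure)
  show "(\<lambda>x. emeasure (K x) U) \<in> borel_measurable borel" if "U \<in> {U. open U}" for U
    unfolding * using assms(3) that by simp
  show "(\<lambda>x. emeasure (K x) UNIV) \<in> borel_measurable borel"
    unfolding * using assms(3)[of UNIV] by simp
qed auto

text \<open>Convolutions such as \<sigma> * \<delta>_y are formed as \<open>M \<bind> K\<close>;
  these facts recover the integral formula on Borel sets.\<close>

lemma bind_kernel:
  fixes K :: "'b::topological_space \<Rightarrow> 'a::topological_space measure"
  assumes M: "finite_measure M" "sets M = sets borel"
    and K: "K \<in> measurable borel (subprob_algebra borel)"
  shows "sets (M \<bind> K) = sets borel" "finite_measure (M \<bind> K)"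
    and "A \<in> sets borel \<Longrightarrow> measure (M \<bind> K) A = (\<integral>x. measure (K x) A \<partial>M)"
    and "A \<in> sets borel \<Longrightarrow> integrable M (\<lambda>x. measure (K x) A)"
proof -
  interpret finite_measure M by fact
  have sp: "space M = UNIV" using sets_eq_imp_space_eq[OF M(2)] by simp
  have KM: "K \<in> measurable M (subprob_algebra borel)" using K M(2) by (simp cong: measurable_cong_sets)
  have sub: "subprob_space (K x)" for x using subprob_space_kernel[OF K] by simp
  have K1: "measure (K x) A \<le> 1" for x A by (rule subprob_space.subprob_measure_le_1[OF sub])
  show s: "sets (M \<bind> K) = sets borel"
    using KM sp by (subst sets_bind[where N=borel]) (auto dest: sets_kernel)
  have int: "integrable M (\<lambda>x. measure (K x) A)" if A: "A \<in> sets borel" for A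
  proof (rule integrable_const_bound[where B=1])
    show "(\<lambda>x. measure (K x) A) \<in> borel_measurable M"
      using measurable_compose[OF KM measurable_measure_subprob_algebra[OF A]] .
  qed (simp add: K1)
  have em: "emeasure (M \<bind> K) A = ennreal (\<integral>x. measure (K x) A \<partial>M)" if A: "A \<in> sets borel" for A
  proof -
    have "emeasure (M \<bind> K) A = (\<integral>\<^sup>+x. emeasure (K x) A \<partial>M)"
      using KM A sp by (intro emeasure_bind) auto
    also have "\<dots> = (\<integral>\<^sup>+x. ennreal (measure (K x) A) \<partial>M)"
      using sub by (intro nn_integral_cong finite_measure.emeasure_eq_measure) (simp add: subprob_space_def)
    also have "\<dots> = ennreal (\<integral>x. measure (K x) A \<partial>M)"
      using int[OF A] by (intro nn_integral_eq_integral) auto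
    finally show ?thesis .
  qed
  show "finite_measure (M \<bind> K)"
    using em[of UNIV] sets_eq_imp_space_eq[OF s] by (intro finite_measureI) simp
  show "integrable M (\<lambda>x. measure (K x) A)" if "A \<in> sets borel" using int that .
  show "measure (M \<bind> K) A = (\<integral>x. measure (K x) A \<partial>M)" if "A \<in> sets borel"
    using em[OF that] by (simp add: measure_def)
qed

lemma integral_bind_kernel:
  fixes K :: "'b::topological_space \<Rightarrow> 'a::topological_space measure" and f :: "'a \<Rightarrow> real"
  assumes M: "finite_measure M" "sets M = sets borel"
    and K: "K \<in> measurable borel (subprob_algebra borel)"
    and f: "continuous_on UNIV f" "\<And>x. \<bar>f x\<bar> \<le> B"
  shows "(\<integral>x. f x \<partial>(M \<bind> K)) = (\<integral>x. (\<integral>y. f y \<partial>K x) \<partial>M)"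
proof (rule integral_bind[where K=borel and B=B and B'=1])
  show "f \<in> borel_measurable borel" using f(1) by (rule borel_measurable_continuous_onI)
  show "K \<in> measurable M (subprob_algebra borel)" using K M(2) by (simp cong: measurable_cong_sets)
  show "finite_measure M" by fact
  show "AE x in M. emeasure (K x) (space (K x)) \<le> ennreal 1"
    using subprob_space_kernel[OF K] by (auto simp: subprob_space.emeasure_space_le_1)
  show "\<bar>f x\<bar> \<le> B" for x by fact
qed

section \<open>Convolution of point masses: semicontinuity, compactness, supports\<close>

locale hypergroup_space =
  fixes conv :: "'a::t2_space \<Rightarrow> 'a \<Rightarrow> 'a measure" and e :: 'a and iv :: "'a \<Rightarrow> 'a"
  assumes hg: "hypergroup conv e iv"
begin

lemma conv_prob: "prob_space (conv x y)"
  and conv_radon: "fin_radon (conv x y)"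
  and conv_compact: "compact (msupp (conv x y))"
  and conv_assoc: "A \<in> sets borel \<Longrightarrow>
    (\<integral>w. measure (conv w z) A \<partial>conv x y) = (\<integral>w. measure (conv x w) A \<partial>conv y z)"
  and conv_weak: "f \<in> Cc \<Longrightarrow> continuous_on UNIV (\<lambda>p. \<integral>t. f t \<partial>conv (fst p) (snd p))"
  and conv_usc: "open U \<Longrightarrow> open {p. msupp (conv (fst p) (snd p)) \<subseteq> U}"
  and conv_e: "conv e x = return borel x" "conv x e = return borel x"
  and iv_cont: "continuous_on UNIV iv"
  and iv_iv: "iv (iv x) = x"
  and conv_iv: "distr (conv x y) borel iv = conv (iv y) (iv x)"
  and e_in: "e \<in> msupp (conv x y) \<longleftrightarrow> x = iv y"
  and lc: "locally_compact_space (euclidean :: 'a topology)"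
  using hg unfolding hypergroup_def by (simp_all add: homeomorphism_def)

lemmas sets_conv = fin_radonD(1)[OF conv_radon]
  and space_conv = fin_radonD(2)[OF conv_radon]
  and conv_finite = fin_radonD(3)[OF conv_radon]

text \<open>This is one half of the portmanteau theorem. A function in \<open>Cc\<close> between the
  indicators of a compact set and of \<open>U\<close> has an integral that depends continuously on
  \<open>p\<close>, exceeds \<open>t\<close> at the given point and is at most the measure of
  \<open>U\<close>.\<close>

lemma conv_lsc:
  assumes U: "open U"
  shows "open {p. t < measure (conv (fst p) (snd p)) U}"
proof (subst open_subopen, clarify)
  fix x y assume "t < measure (conv (fst (x, y)) (snd (x, y))) U"
  then obtain C where C: "compact C" "C \<subseteq> U" "t < measure (conv x y) C"
    using fin_radon_open_compact[OF conv_radon U, of t x y] by auto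
  obtain f where f: "f \<in> Cc" "\<And>x. 0 \<le> f x" "\<And>x. f x \<le> 1" "\<And>x. x \<in> C \<Longrightarrow> f x = 1" "\<And>x. x \<notin> U \<Longrightarrow> f x = 0"
    using Urysohn_Cc[OF lc C(1) U C(2)] by metis
  have fi: "integrable (conv x y) f" for x y
    using conv_finite sets_conv CcD(1)[OF f(1)] f(2,3)
    by (intro bounded_continuous_integrable[where B=1]) auto
  have "measure (conv x y) C = (\<integral>t. indicator C t \<partial>conv x y)" by (simp add: space_conv)
  also have "\<dots> \<le> (\<integral>t. f t \<partial>conv x y)"
    using f C(1) fi finite_measure.emeasure_finite[OF conv_finite]
    by (intro integral_mono) (auto split: split_indicator simp: compact_imp_closed sets_conv less_top[symmetric])
  finally have 1: "t < (\<integral>t. f t \<partial>conv x y)" using C(3) by simp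
  have 2: "(\<integral>t. f t \<partial>conv x y) \<le> measure (conv x y) U" for x y
  proof -
    have "(\<integral>t. f t \<partial>conv x y) \<le> (\<integral>t. indicator U t \<partial>conv x y)"
      using f U fi finite_measure.emeasure_finite[OF conv_finite]
      by (intro integral_mono) (auto split: split_indicator simp: sets_conv less_top[symmetric])
    then show ?thesis by (simp add: space_conv)
  qed
  have "open {p. t < (\<integral>t. f t \<partial>conv (fst p) (snd p))}"
    using conv_weak[OF f(1)] by (intro open_Collect_less continuous_intros)
  with 1 2 show "\<exists>T. open T \<and> (x, y) \<in> T \<and> T \<subseteq> {p. t < measure (conv (fst p) (snd p)) U}"
    by (intro exI[of _ "{p. t < (\<integral>t. f t \<partial>conv (fst p) (snd p))}"]) (auto intro: less_le_trans)
qed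

lemma conv_lsc_left: "open U \<Longrightarrow> open {x. t < measure (conv x y) U}"
  and conv_lsc_right: "open U \<Longrightarrow> open {y. t < measure (conv x y) U}"
  using open_section[OF conv_lsc[of U t]] by simp_all

lemma kernel_left: "(\<lambda>x. conv x y) \<in> measurable borel (subprob_algebra borel)"
  and kernel_right: "conv x \<in> measurable borel (subprob_algebra borel)"
  by (intro prob_kernelI lsc_borel_measurable conv_prob sets_conv conv_lsc_left conv_lsc_right; assumption)+

lemma conv_assoc_bind: "conv x y \<bind> (\<lambda>w. conv w z) = conv y z \<bind> conv x"
proof (rule measure_eqI)
  note L = bind_kernel[OF conv_finite[of x y] sets_conv kernel_left[of z]]
    and R = bind_kernel[OF conv_finite[of y z] sets_conv kernel_right[of x]]
  show "sets (conv x y \<bind> (\<lambda>w. conv w z)) = sets (conv y z \<bind> conv x)" using L(1) R(1) by simp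
  fix A assume "A \<in> sets (conv x y \<bind> (\<lambda>w. conv w z))"
  then have "A \<in> sets borel" using L(1) by simp
  then show "emeasure (conv x y \<bind> (\<lambda>w. conv w z)) A = emeasure (conv y z \<bind> conv x) A"
    using L(2,3) R(2,3) conv_assoc by (simp add: finite_measure.emeasure_eq_measure)
qed

text \<open>The support map is upper semicontinuous with compact values. A finite subcover of one
  value still covers all values in a neighbourhood, and finitely many such neighbourhoods cover
  \<open>D\<close>.\<close>

lemma compact_conv_image:
  assumes "compact D"
  shows "compact (\<Union>p\<in>D. msupp (conv (fst p) (snd p)))"
proof (rule Topological_Spaces.compactI)
  fix C assume C: "\<forall>t\<in>C. open t" "(\<Union>p\<in>D. msupp (conv (fst p) (snd p))) \<subseteq> \<Union>C"
  have "\<exists>T\<subseteq>C. finite T \<and> msupp (conv (fst p) (snd p)) \<subseteq> \<Union>T" if "p \<in> D" for p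
    using compactE[OF conv_compact, of "fst p" "snd p" C] C that by (metis SUP_le_iff)
  then obtain T where T: "\<And>p. p \<in> D \<Longrightarrow> T p \<subseteq> C \<and> finite (T p) \<and> msupp (conv (fst p) (snd p)) \<subseteq> \<Union>(T p)"
    by metis
  define W where "W p = {q. msupp (conv (fst q) (snd q)) \<subseteq> \<Union>(T p)}" for p
  have W: "open (W p)" if "p \<in> D" for p
    unfolding W_def using T[OF that] C(1) by (intro conv_usc open_Union) blast
  have pW: "p \<in> W p" if "p \<in> D" for p using T[OF that] by (simp add: W_def)
  have "D \<subseteq> (\<Union>p\<in>D. W p)" using pW by blast
  from compactE_image[OF assms W this] obtain F where F: "F \<subseteq> D" "finite F" "D \<subseteq> (\<Union>p\<in>F. W p)"
    by blast
  show "\<exists>C'\<subseteq>C. finite C' \<and> (\<Union>p\<in>D. msupp (conv (fst p) (snd p))) \<subseteq> \<Union>C'"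
  proof (intro exI[of _ "\<Union>p\<in>F. T p"] conjI)
    show "(\<Union>p\<in>F. T p) \<subseteq> C" "finite (\<Union>p\<in>F. T p)" using F(1,2) T by blast+
    show "(\<Union>p\<in>D. msupp (conv (fst p) (snd p))) \<subseteq> \<Union>(\<Union>p\<in>F. T p)"
    proof clarify
      fix a b t assume "(a, b) \<in> D" and t: "t \<in> msupp (conv (fst (a, b)) (snd (a, b)))"
      then obtain p where "p \<in> F" "(a, b) \<in> W p" using F(3) by blast
      with t show "t \<in> \<Union>(\<Union>p\<in>F. T p)" unfolding W_def by blast
    qed
  qed
qed

text \<open>As \<open>z\<close> lies in the support of \<open>conv x y\<close>, the identity is in
  the support of \<delta>_x * \<delta>_y * \<delta>_w for \<open>w = iv z\<close>. Associating the
  other way, it must come from some \<open>conv x v\<close> with \<open>v\<close> in the support of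
  \<open>conv y (iv z)\<close>, and only \<open>v = iv x\<close> qualifies. The involution then
  gives the claim.\<close>

lemma msupp_conv_shift:
  assumes z: "z \<in> msupp (conv x y)"
  shows "x \<in> msupp (conv z (iv y))"
proof -
  let ?D = "msupp (conv y (iv z))"
  have "iv x \<in> ?D"
  proof (rule ccontr)
    assume nin: "iv x \<notin> ?D"
    \<comment> \<open>\<open>S\<close> is the product of \<open>x\<close> with that support. It is
      compact, hence closed, so if \<open>iv x\<close> were missing its complement would be an open
      neighbourhood of \<open>e\<close>.\<close>
    define S where "S = (\<Union>p\<in>{x} \<times> ?D. msupp (conv (fst p) (snd p)))"
    have "compact S" unfolding S_def
      by (intro compact_conv_image compact_Times conv_compact) auto
    then have U: "open (- S)" by (simp add: compact_imp_closed open_Compl)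
    have eU: "e \<in> - S" using nin iv_iv by (auto simp: S_def e_in)
    have "measure (conv x w) (- S) = 0" if "w \<in> ?D" for w
      using that by (intro fin_radon_open_null conv_radon U) (auto simp: S_def)
    then have "(\<integral>w. measure (conv x w) (- S) \<partial>conv y (iv z)) = 0"
      by (intro integral_zero_on_msupp conv_radon)
    then have "(\<integral>w. measure (conv w (iv z)) (- S) \<partial>conv x y) = 0"
      using conv_assoc[of "- S"] U by simp
    then have "measure (conv z (iv z)) (- S) = 0"
      using z by (intro lsc_zero_on_msupp[OF conv_finite sets_conv conv_lsc_left[OF U]])
        (auto intro: prob_space.prob_le_1[OF conv_prob])
    moreover have "e \<in> msupp (conv z (iv z))" by (simp add: e_in iv_iv)
    ultimately show False
      using msupp_open_pos[OF conv_finite U eU] by fastforce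
  qed
  \<comment> \<open>The involution carries \<open>conv y (iv z)\<close> to
    \<open>conv z (iv y)\<close> and \<open>iv x\<close> to \<open>x\<close>.\<close>
  have "x \<in> msupp (distr (conv y (iv z)) borel iv)"
    unfolding msupp_def
  proof (intro CollectI allI impI)
    fix U assume U: "open U \<and> x \<in> U"
    have "open (iv -` U)" using U iv_cont by (auto intro: open_vimage)
    moreover have "iv x \<in> iv -` U" using U iv_iv by simp
    ultimately have "emeasure (conv y (iv z)) (iv -` U) \<noteq> 0"
      using \<open>iv x \<in> ?D\<close> by (auto simp: msupp_def)
    moreover have "iv \<in> measurable (conv y (iv z)) borel"
      using borel_measurable_continuous_onI[OF iv_cont] sets_conv by (simp cong: measurable_cong_sets)
    ultimately show "emeasure (distr (conv y (iv z)) borel iv) U \<noteq> 0"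
      using U by (simp add: emeasure_distr space_conv)
  qed
  then show ?thesis by (simp add: conv_iv iv_iv)
qed

end

section \<open>Convolution with a probability measure\<close>

context hypergroup_space
begin

lemma conv_integral_bound:
  fixes f :: "'a \<Rightarrow> real"
  assumes "\<And>x. \<bar>f x\<bar> \<le> B"
  shows "\<bar>\<integral>t. f t \<partial>conv x y\<bar> \<le> B"
  using bounded_integral_bound[OF conv_finite[of x y] assms] prob_space.prob_space[OF conv_prob, of x y]
  by simp

lemma translate_vanishes_at_infinity:
  assumes p: "fin_radon p" and f: "f \<in> Cc" and \<epsilon>: "0 < \<epsilon>"
  shows "\<exists>Q. compact Q \<and> (\<forall>x. x \<notin> Q \<longrightarrow> \<bar>\<integral>y. (\<integral>t. f t \<partial>conv x y) \<partial>p\<bar> < \<epsilon>)"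
proof -
  interpret finite_measure p using fin_radonD(3)[OF p] .
  obtain B where B: "\<And>x. \<bar>f x\<bar> \<le> B" using CcD(2)[OF f] by blast
  have B0: "0 \<le> B" using B[of undefined] by linarith
  let ?S = "closure {x. f x \<noteq> 0}"
  have S: "compact ?S" using f by (simp add: Cc_def)
  obtain C where C: "compact C" "measure p (- C) < \<epsilon> / (B + 1)"
    using fin_radon_imp_tight[OF p] \<epsilon> B0 unfolding tight_measure_def
    by (meson add_nonneg_pos divide_pos_pos zero_less_one)
  define Q where "Q = (\<Union>q\<in>?S \<times> iv ` C. msupp (conv (fst q) (snd q)))"
  have "compact Q" unfolding Q_def
    by (intro compact_conv_image compact_Times S compact_continuous_image continuous_on_subset[OF iv_cont] C(1)) auto
  moreover have "\<bar>\<integral>y. (\<integral>t. f t \<partial>conv x y) \<partial>p\<bar> < \<epsilon>" if x: "x \<notin> Q" for x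
  proof -
    have zero: "(\<integral>t. f t \<partial>conv x y) = 0" if y: "y \<in> C" for y
    proof (rule integral_zero_on_msupp[OF conv_radon])
      fix z assume z: "z \<in> msupp (conv x y)"
      show "f z = 0"
      proof (rule ccontr)
        assume "f z \<noteq> 0"
        then have "z \<in> ?S" using closure_subset[of "{x. f x \<noteq> 0}"] by blast
        then have "(z, iv y) \<in> ?S \<times> iv ` C" using y by simp
        then have "x \<in> Q" using msupp_conv_shift[OF z] unfolding Q_def by force
        with x show False by simp
      qed
    qed
    have cC: "- C \<in> sets p" using C(1) fin_radonD(1)[OF p] by (auto simp: compact_imp_closed)
    have hi: "integrable p (\<lambda>y. \<integral>t. f t \<partial>conv x y)"
      using continuous_sections(1)[OF conv_weak[OF f], of x] conv_integral_bound[OF B]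
      by (intro bounded_continuous_integrable[where B=B] fin_radonD[OF p]) auto
    have "\<bar>\<integral>y. (\<integral>t. f t \<partial>conv x y) \<partial>p\<bar> \<le> (\<integral>y. \<bar>\<integral>t. f t \<partial>conv x y\<bar> \<partial>p)"
      by (rule integral_abs_bound)
    also have "\<dots> \<le> (\<integral>y. B * indicator (- C) y \<partial>p)"
      using hi cC zero conv_integral_bound[of f B x, OF B] B0
      by (intro integral_mono) (auto split: split_indicator simp: emeasure_finite less_top[symmetric])
    also have "\<dots> = B * measure p (- C)" using cC by (simp add: fin_radonD(2)[OF p] emeasure_finite)
    also have "\<dots> \<le> B * (\<epsilon> / (B + 1))" using C(2) B0 by (intro mult_left_mono) auto
    also have "\<dots> < \<epsilon>" using B0 \<epsilon> by (simp add: field_simps)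
    finally show ?thesis .
  qed
  ultimately show ?thesis by blast
qed

end

locale hypergroup_walk = hypergroup_space conv e iv
  for conv :: "'a::t2_space \<Rightarrow> 'a \<Rightarrow> 'a measure" and e :: 'a and iv :: "'a \<Rightarrow> 'a" +
  fixes \<sigma> :: "'a measure"
  assumes \<sigma>_prob: "prob_space \<sigma>" and \<sigma>_radon: "fin_radon \<sigma>"
begin

lemmas sets_\<sigma> = fin_radonD(1)[OF \<sigma>_radon]
  and \<sigma>_finite = fin_radonD(3)[OF \<sigma>_radon]

lemma measure_\<sigma>: "measure \<sigma> UNIV = 1"
  using prob_space.prob_space[OF \<sigma>_prob] fin_radonD(2)[OF \<sigma>_radon] by simp

text \<open>This is \<delta>_x * \<sigma>.\<close>

abbreviation right_step :: "'a \<Rightarrow> 'a measure" where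
  "right_step x \<equiv> \<sigma> \<bind> conv x"

text \<open>This is \<sigma> * \<delta>_y; mixing it over \<open>y\<close> by \<open>p\<close> gives
  \<sigma> * p.\<close>

abbreviation left_step :: "'a \<Rightarrow> 'a measure" where
  "left_step y \<equiv> \<sigma> \<bind> (\<lambda>x. conv x y)"

lemma measure_conv_UNIV: "measure (conv x y) UNIV = 1"
  using prob_space.prob_space[OF conv_prob, of x y] by (simp add: space_conv)

text \<open>If a compact \<open>S\<close> carries most of \<open>\<sigma>\<close>, then the product
  of \<open>x\<close> with \<open>S\<close> is compact and carries all of \<open>conv x s\<close>
  for each \<open>s\<close> in \<open>S\<close>.\<close>

lemma right_step_tight: "tight_measure (right_step x)"
  unfolding tight_measure_def
proof (intro conjI allI impI)
  note R = bind_kernel[OF \<sigma>_finite sets_\<sigma> kernel_right[of x]]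
  interpret \<sigma>: finite_measure \<sigma> by (rule \<sigma>_finite)
  show "finite_measure (right_step x)" "sets (right_step x) = sets borel" using R by auto
  fix \<epsilon> :: real assume "0 < \<epsilon>"
  then obtain S where S: "compact S" "measure \<sigma> (- S) < \<epsilon>"
    using fin_radon_imp_tight[OF \<sigma>_radon] by (auto simp: tight_measure_def)
  define D where "D = (\<Union>p\<in>{x} \<times> S. msupp (conv (fst p) (snd p)))"
  have D: "compact D" unfolding D_def using S(1) by (intro compact_conv_image compact_Times) auto
  then have U: "open (- D)" by (simp add: compact_imp_closed open_Compl)
  have cS: "- S \<in> sets \<sigma>" using S(1) sets_\<sigma> by (auto simp: compact_imp_closed)
  have z: "measure (conv x s) (- D) = 0" if "s \<in> S" for s
    using that by (intro fin_radon_open_null conv_radon U) (auto simp: D_def)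
  have "measure (right_step x) (- D) = (\<integral>s. measure (conv x s) (- D) \<partial>\<sigma>)" using R(3) U by simp
  also have "\<dots> \<le> (\<integral>s. indicator (- S) s \<partial>\<sigma>)"
    using R(4)[of "- D"] U cS z prob_space.prob_le_1[OF conv_prob]
    by (intro integral_mono) (auto split: split_indicator simp: \<sigma>.emeasure_finite less_top[symmetric])
  also have "\<dots> = measure \<sigma> (- S)" by (simp add: fin_radonD(2)[OF \<sigma>_radon])
  finally show "\<exists>C. compact C \<and> measure (right_step x) (- C) < \<epsilon>"
    using D S(2) by (intro exI[of _ D]) simp
qed

lemma measure_right_step_UNIV: "measure (right_step x) UNIV = 1"
  using bind_kernel(3)[OF \<sigma>_finite sets_\<sigma> kernel_right[of x], of UNIV] measure_conv_UNIV measure_\<sigma>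
  by (simp add: fin_radonD(2)[OF \<sigma>_radon])

text \<open>This makes \<sigma> * p available as the measure
  \<open>p \<bind> left_step\<close>.\<close>

lemma kernel_left_step: "left_step \<in> measurable borel (subprob_algebra borel)"
proof (rule prob_kernelI)
  note L = bind_kernel[OF \<sigma>_finite sets_\<sigma> kernel_left]
  show s: "sets (left_step y) = sets borel" for y by (rule L)
  show "prob_space (left_step y)" for y
  proof (rule prob_spaceI)
    have "measure (left_step y) UNIV = 1"
      using L(3)[of UNIV y] measure_conv_UNIV measure_\<sigma> by (simp add: fin_radonD(2)[OF \<sigma>_radon])
    then show "emeasure (left_step y) (space (left_step y)) = 1"
      using L(2)[of y] sets_eq_imp_space_eq[OF s] by (simp add: finite_measure.emeasure_eq_measure)
  qed
  fix U :: "'a set" assume U: "open U"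
  have "(\<lambda>y. \<integral>x. measure (conv x y) U \<partial>\<sigma>) \<in> borel_measurable borel"
  proof (rule lsc_integral_measurable[OF \<sigma>_radon])
    fix t
    \<comment> \<open>The parameter \<open>y\<close> has to come first, hence the swap of
      coordinates.\<close>
    have "continuous_on UNIV (\<lambda>p :: 'a \<times> 'a. (snd p, fst p))" by (intro continuous_intros)
    then have "open ((\<lambda>p. (snd p, fst p)) -` {p. t < measure (conv (fst p) (snd p)) U})"
      by (intro open_vimage conv_lsc U)
    then show "open {p. t < measure (conv (snd p) (fst p)) U}" by (simp add: vimage_def)
  qed (auto intro: prob_space.prob_le_1[OF conv_prob])
  then show "(\<lambda>y. measure (left_step y) U) \<in> borel_measurable borel" using L(3) U by simp
qed

text \<open>The hypothesis \<open>inv\<close> says p - q = \<sigma> * (p - q), and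
  \<open>F x\<close> is the integral of \<open>f\<close> against \<delta>_x * (p - q). Inserting
  \<sigma> and associating the other way turns it into the average of \<open>F\<close> under
  \<delta>_x * \<sigma>.\<close>

lemma harmonic_difference:
  assumes p: "fin_radon p" and q: "fin_radon q" and f: "f \<in> Cc"
    and inv: "\<And>A. A \<in> sets borel \<Longrightarrow> measure p A - measure q A =
      (\<integral>y. (\<integral>x. measure (conv x y) A \<partial>\<sigma>) \<partial>p) - (\<integral>y. (\<integral>x. measure (conv x y) A \<partial>\<sigma>) \<partial>q)"
  defines "F \<equiv> \<lambda>x. (\<integral>y. (\<integral>t. f t \<partial>conv x y) \<partial>p) - (\<integral>y. (\<integral>t. f t \<partial>conv x y) \<partial>q)"
  shows "continuous_on UNIV F" "\<exists>B. \<forall>x. \<bar>F x\<bar> \<le> B" "F x = (\<integral>z. F z \<partial>right_step x)"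
proof -
  obtain B where B: "\<And>x. \<bar>f x\<bar> \<le> B" using CcD(2)[OF f] by blast
  note fc = CcD(1)[OF f]
  define h where "h p = (\<integral>t. f t \<partial>conv (fst p) (snd p))" for p
  have h: "continuous_on UNIV h" unfolding h_def by (rule conv_weak[OF f])
  have hB: "\<bar>h p\<bar> \<le> B" for p unfolding h_def by (rule conv_integral_bound[OF B])
  define G where "G p x = (\<integral>y. h (x, y) \<partial>p)" for p x
  have F: "F x = G p x - G q x" for x by (simp add: F_def G_def h_def)
  have Gc: "continuous_on UNIV (G p)" if "fin_radon p" for p
    unfolding G_def by (rule tight_integral_continuous[OF fin_radon_imp_tight[OF that] h hB])
  have Gb: "\<bar>G p x\<bar> \<le> B * measure p (space p)" if "fin_radon p" for p x
    unfolding G_def by (rule bounded_integral_bound[OF fin_radonD(3)[OF that] hB])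
  show "continuous_on UNIV F"
    unfolding F using Gc[OF p] Gc[OF q] by (intro continuous_intros)
  have "\<bar>F x\<bar> \<le> B * measure p (space p) + B * measure q (space q)" for x
    unfolding F using Gb[OF p, of x] Gb[OF q, of x] by linarith
  then show "\<exists>B. \<forall>x. \<bar>F x\<bar> \<le> B" by blast
  \<comment> \<open>For the fixed \<open>x\<close>, \<open>F x\<close> is the integral of
    \<open>g\<close> against p - q, so invariance can be applied to \<open>g\<close>.\<close>
  define g where "g w = h (x, w)" for w
  have gc: "continuous_on UNIV g" unfolding g_def by (rule continuous_sections(1)[OF h])
  have gB: "\<bar>g w\<bar> \<le> B" for w unfolding g_def by (rule hB)
  note R = bind_kernel[OF \<sigma>_finite sets_\<sigma> kernel_right[of x]]
  note L = bind_kernel[OF \<sigma>_finite sets_\<sigma> kernel_left]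
  \<comment> \<open>This is \<delta>_x * (\<sigma> * \<delta>_y) = (\<delta>_x * \<sigma>) *
    \<delta>_y, tested on \<open>f\<close>.\<close>
  have gL: "(\<integral>w. g w \<partial>left_step y) = (\<integral>z. h (z, y) \<partial>right_step x)" for y
  proof -
    have "(\<integral>w. g w \<partial>left_step y) = (\<integral>s. (\<integral>w. g w \<partial>conv s y) \<partial>\<sigma>)"
      by (rule integral_bind_kernel[OF \<sigma>_finite sets_\<sigma> kernel_left gc gB])
    also have "\<dots> = (\<integral>s. (\<integral>z. h (z, y) \<partial>conv x s) \<partial>\<sigma>)"
    proof (rule Bochner_Integration.integral_cong[OF refl])
      fix s
      have "(\<integral>w. g w \<partial>conv s y) = (\<integral>t. f t \<partial>(conv s y \<bind> conv x))"
        unfolding g_def h_def fst_conv snd_conv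
        by (rule integral_bind_kernel[OF conv_finite sets_conv kernel_right fc B, symmetric])
      also have "\<dots> = (\<integral>t. f t \<partial>(conv x s \<bind> (\<lambda>w. conv w y)))" by (simp add: conv_assoc_bind)
      also have "\<dots> = (\<integral>z. h (z, y) \<partial>conv x s)"
        unfolding h_def fst_conv snd_conv
        by (rule integral_bind_kernel[OF conv_finite sets_conv kernel_left fc B])
      finally show "(\<integral>w. g w \<partial>conv s y) = (\<integral>z. h (z, y) \<partial>conv x s)" .
    qed
    also have "\<dots> = (\<integral>z. h (z, y) \<partial>right_step x)"
      by (rule integral_bind_kernel[OF \<sigma>_finite sets_\<sigma> kernel_right continuous_sections(2)[OF h] hB, symmetric])
    finally show ?thesis .
  qed
  have gp: "(\<integral>w. g w \<partial>(p \<bind> left_step)) = (\<integral>z. G p z \<partial>right_step x)" if p: "fin_radon p" for p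
  proof -
    have "(\<integral>w. g w \<partial>(p \<bind> left_step)) = (\<integral>y. (\<integral>w. g w \<partial>left_step y) \<partial>p)"
      by (rule integral_bind_kernel[OF fin_radonD(3,1)[OF p] kernel_left_step gc gB])
    also have "\<dots> = (\<integral>y. (\<integral>z. h (z, y) \<partial>right_step x) \<partial>p)" by (simp add: gL)
    also have "\<dots> = (\<integral>z. G p z \<partial>right_step x)"
      unfolding G_def
      by (rule Fubini_continuous_tight[OF right_step_tight fin_radon_imp_tight[OF p] h hB, symmetric])
    finally show ?thesis .
  qed
  note P = bind_kernel[OF fin_radonD(3,1)[OF p] kernel_left_step]
    and Q = bind_kernel[OF fin_radonD(3,1)[OF q] kernel_left_step]
  \<comment> \<open>Invariance of p - q, tested on \<open>g\<close>, with all subtractions moved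
    across.\<close>
  have "(\<integral>w. g w \<partial>p) + (\<integral>w. g w \<partial>(q \<bind> left_step)) = (\<integral>w. g w \<partial>q) + (\<integral>w. g w \<partial>(p \<bind> left_step))"
  proof (rule integral_add_eq_of_measure_add_eq[OF _ _ _ _ _ _ _ _ _ gc gB])
    show "measure p A + measure (q \<bind> left_step) A = measure q A + measure (p \<bind> left_step) A"
      if "A \<in> sets borel" for A
      using inv[OF that] P(3)[OF that] Q(3)[OF that] L(3)[OF that] by simp
  qed (use fin_radonD[OF p] fin_radonD[OF q] P(1,2) Q(1,2) in auto)
  moreover have "(\<integral>w. g w \<partial>p) = G p x" for p by (simp add: G_def g_def)
  moreover have "integrable (right_step x) (G p)" if "fin_radon p" for p
    using R(2,1) Gc[OF that] Gb[OF that] by (rule bounded_continuous_integrable)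
  ultimately show "F x = (\<integral>z. F z \<partial>right_step x)"
    unfolding F using gp p q by simp
qed

end

section \<open>The maximum principle\<close>

lemma msupp_return_subset:
  fixes x :: "'a::t1_space"
  shows "msupp (return borel x) \<subseteq> {x}"
proof
  fix y assume y: "y \<in> msupp (return borel x)"
  show "y \<in> {x}"
  proof (rule ccontr)
    assume "y \<notin> {x}"
    moreover have "open (- {x})" by (simp add: open_Compl)
    ultimately have "emeasure (return borel x) (- {x}) \<noteq> 0" using y unfolding msupp_def by blast
    then show False by simp
  qed
qed

context hypergroup_walk
begin

context
  fixes F :: "'a \<Rightarrow> real" and M :: real
  assumes Fc: "continuous_on UNIV F" and Fb: "\<exists>B. \<forall>x. \<bar>F x\<bar> \<le> B"
    and harmonic: "\<And>x. F x = (\<integral>z. F z \<partial>right_step x)"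
    and Fle: "\<And>x. F x \<le> M"
begin

lemma open_below_max: "open {x. F x < M}"
  using Fc by (intro open_Collect_less continuous_intros)

text \<open>\<open>F x\<close> is an average of values at most \<open>M\<close>, so \<open>F\<close>
  equals \<open>M\<close> almost everywhere for \<delta>_x * \<sigma>. The mass that
  \<open>conv x s\<close> gives to \<open>{x. F x < M}\<close> is lower semicontinuous in
  \<open>s\<close> and has \<open>\<sigma>\<close>-integral zero, so it vanishes at every
  \<open>s\<close> in the support.\<close>

lemma max_step:
  assumes "F x = M" "s \<in> msupp \<sigma>"
  shows "measure (conv x s) {x. F x < M} = 0"
proof -
  let ?N = "{x. F x < M}" and ?\<tau> = "right_step x"
  note R = bind_kernel[OF \<sigma>_finite sets_\<sigma> kernel_right[of x]]
  interpret \<tau>: finite_measure ?\<tau> by (rule R)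
  have sp: "space ?\<tau> = UNIV" using sets_eq_imp_space_eq[OF R(1)] by simp
  obtain B where B: "\<And>x. \<bar>F x\<bar> \<le> B" using Fb by blast
  have Fi: "integrable ?\<tau> F" using \<tau>.finite_measure_axioms R(1) Fc B by (rule bounded_continuous_integrable)
  have "(\<integral>z. M - F z \<partial>?\<tau>) = 0"
    using Fi harmonic[of x] assms(1) measure_right_step_UNIV[of x] by (simp add: sp)
  then have "AE z in ?\<tau>. M - F z = 0"
    using Fi Fle by (subst (asm) integral_nonneg_eq_0_iff_AE) auto
  then have "AE z in ?\<tau>. z \<notin> ?N" by eventually_elim auto
  then have "measure ?\<tau> ?N = 0"
    using open_below_max R(1) by (subst (asm) AE_iff_measurable[of ?N]) (auto simp: measure_def sp)
  then have "(\<integral>s. measure (conv x s) ?N \<partial>\<sigma>) = 0"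
    using R(3)[of ?N] open_below_max by simp
  then show ?thesis
    using assms(2) by (intro lsc_zero_on_msupp[OF \<sigma>_finite sets_\<sigma> conv_lsc_right[OF open_below_max]])
      (auto intro: prob_space.prob_le_1[OF conv_prob])
qed

lemma null_imp_msupp_max:
  assumes "measure (conv x y) {x. F x < M} = 0" "z \<in> msupp (conv x y)"
  shows "F z = M"
  using assms msupp_open_pos[OF conv_finite open_below_max _ assms(2)] Fle[of z] by fastforce

text \<open>Stating maximality as a null set rather than through supports lets associativity act
  directly on integrals.\<close>

lemma max_powers:
  assumes "F x = M" "t \<in> hset_pow conv e (msupp \<sigma>) n"
  shows "measure (conv x t) {x. F x < M} = 0"
  using assms(2)
proof (induction n arbitrary: t)
  case 0
  \<comment> \<open>The zeroth power is \<open>{e}\<close>, and \<delta>_x * \<delta>_e is the point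
    mass at \<open>x\<close>, where \<open>F\<close> is maximal.\<close>
  then have "msupp (conv x t) \<inter> {x. F x < M} = {}"
    using msupp_return_subset[of x] assms(1) by (auto simp: conv_e)
  then show ?case by (intro fin_radon_open_null conv_radon open_below_max)
next
  case (Suc n)
  let ?N = "{x. F x < M}"
  from Suc.prems obtain a s where a: "a \<in> hset_pow conv e (msupp \<sigma>) n" and s: "s \<in> msupp \<sigma>"
    and t: "t \<in> msupp (conv a s)" by (auto simp: hset_prod_def)
  \<comment> \<open>By induction \<open>F\<close> is maximal on the support of
    \<open>conv x a\<close>, and a further step by \<open>s\<close> preserves this. Associativity
    moves the conclusion to almost all points for \<open>conv a s\<close>, and semicontinuity to its
    whole support, including \<open>t\<close>.\<close>
  have "measure (conv w s) ?N = 0" if "w \<in> msupp (conv x a)" for w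
    using max_step[OF null_imp_msupp_max[OF Suc.IH[OF a] that] s] .
  then have "(\<integral>w. measure (conv w s) ?N \<partial>conv x a) = 0"
    by (intro integral_zero_on_msupp conv_radon)
  then have "(\<integral>w. measure (conv x w) ?N \<partial>conv a s) = 0"
    using conv_assoc[of ?N] open_below_max by simp
  then show ?case
    using t by (intro lsc_zero_on_msupp[OF conv_finite sets_conv conv_lsc_right[OF open_below_max]])
      (auto intro: prob_space.prob_le_1[OF conv_prob])
qed

lemma max_everywhere:
  assumes nd: "nondegenerate conv e \<sigma>" and x0: "F x0 = M"
  shows "F z = M"
proof -
  have null: "measure (conv x t) {x. F x < M} = 0" if x: "F x = M" for x t
  proof (rule ccontr)
    assume "measure (conv x t) {x. F x < M} \<noteq> 0"
    \<comment> \<open>This set is open by lower semicontinuity, so if it is nonempty it meets the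
      dense union of the powers.\<close>
    then have "t \<in> {t. 0 < measure (conv x t) {x. F x < M}}" by (simp add: zero_less_measure_iff)
    then have "{t. 0 < measure (conv x t) {x. F x < M}} \<inter> closure (\<Union>n\<in>{1..}. hset_pow conv e (msupp \<sigma>) n) \<noteq> {}"
      using nd unfolding nondegenerate_def by blast
    then have "{t. 0 < measure (conv x t) {x. F x < M}} \<inter> (\<Union>n\<in>{1..}. hset_pow conv e (msupp \<sigma>) n) \<noteq> {}"
      using open_Int_closure_eq_empty[OF conv_lsc_right[OF open_below_max]] by blast
    then obtain t' n where "t' \<in> hset_pow conv e (msupp \<sigma>) n" "0 < measure (conv x t') {x. F x < M}"
      by blast
    with max_powers[OF x] show False by fastforce
  qed
  have "e \<in> msupp (conv x0 (iv x0))" by (simp add: e_in iv_iv)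
  then have e: "F e = M" using null_imp_msupp_max[OF null[OF x0]] by blast
  have "measure (return borel z) {x. F x < M} = 0" using null[OF e, of z] by (simp add: conv_e)
  then show ?thesis
    using Fle[of z] open_below_max by (auto simp: measure_return indicator_def split: if_splits)
qed

end

text \<open>Since \<delta>_e * \<delta>_y is the point mass at \<open>y\<close>, the claim is that
  the harmonic function \<open>F\<close> is nonpositive at \<open>e\<close>.\<close>

lemma difference_nonpos:
  assumes p: "fin_radon p" and q: "fin_radon q" and f: "f \<in> Cc"
    and inv: "\<And>A. A \<in> sets borel \<Longrightarrow> measure p A - measure q A =
      (\<integral>y. (\<integral>x. measure (conv x y) A \<partial>\<sigma>) \<partial>p) - (\<integral>y. (\<integral>x. measure (conv x y) A \<partial>\<sigma>) \<partial>q)"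
    and nc: "\<not> compact (UNIV :: 'a set)" and nd: "nondegenerate conv e \<sigma>"
  shows "(\<integral>x. f x \<partial>p) \<le> (\<integral>x. f x \<partial>q)"
proof -
  define F where "F x = (\<integral>y. (\<integral>t. f t \<partial>conv x y) \<partial>p) - (\<integral>y. (\<integral>t. f t \<partial>conv x y) \<partial>q)" for x
  note H = harmonic_difference[OF p q f inv, folded F_def]
  have "F e \<le> 0"
  proof (rule ccontr)
    assume "\<not> F e \<le> 0"
    \<comment> \<open>One half for each of the two integrals in \<open>F\<close>, so that
      \<open>F\<close> stays below \<open>F e\<close> outside a compact set.\<close>
    then have pos: "0 < F e / 2" by simp
    obtain Q1 where Q1: "compact Q1" "\<And>x. x \<notin> Q1 \<Longrightarrow> \<bar>\<integral>y. (\<integral>t. f t \<partial>conv x y) \<partial>p\<bar> < F e / 2"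
      using translate_vanishes_at_infinity[OF p f pos] by blast
    obtain Q2 where Q2: "compact Q2" "\<And>x. x \<notin> Q2 \<Longrightarrow> \<bar>\<integral>y. (\<integral>t. f t \<partial>conv x y) \<partial>q\<bar> < F e / 2"
      using translate_vanishes_at_infinity[OF q f pos] by blast
    define Q where "Q = Q1 \<union> Q2"
    have Q: "compact Q" using Q1 Q2 by (simp add: Q_def compact_Un)
    have small: "F x < F e" if "x \<notin> Q" for x
      using Q1(2)[of x] Q2(2)[of x] that unfolding Q_def F_def by auto
    have eQ: "e \<in> Q" using small[of e] by blast
    obtain x0 where x0: "x0 \<in> Q" "\<And>y. y \<in> Q \<Longrightarrow> F y \<le> F x0"
      using continuous_attains_sup[OF Q _ continuous_on_subset[OF H(1)]] eQ by blast
    \<comment> \<open>The maximum over \<open>Q\<close> is global: \<open>e\<close> lies in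
      \<open>Q\<close>, and values outside \<open>Q\<close> are below \<open>F e\<close>.\<close>
    have max: "F x \<le> F x0" for x
      using x0(2)[of x] x0(2)[OF eQ] small[of x] by (cases "x \<in> Q") auto
    \<comment> \<open>Non-compactness enters here: it supplies a point where \<open>F\<close> is
      strictly below its maximum.\<close>
    obtain z where "z \<notin> Q" using nc Q by (metis UNIV_eq_I)
    then have "F z < F x0" using small x0(2)[OF eQ] by fastforce
    moreover have "F z = F x0" by (rule max_everywhere[OF H max nd refl])
    ultimately show False by simp
  qed
  moreover have "(\<integral>t. f t \<partial>conv e y) = f y" for y
    using borel_measurable_continuous_onI[OF CcD(1)[OF f]] by (simp add: conv_e integral_return)
  ultimately show ?thesis by (simp add: F_def)
qed

lemma harmonic_difference_zero:
  assumes p: "fin_radon p" and q: "fin_radon q"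
    and inv: "\<And>A. A \<in> sets borel \<Longrightarrow> measure p A - measure q A =
      (\<integral>y. (\<integral>x. measure (conv x y) A \<partial>\<sigma>) \<partial>p) - (\<integral>y. (\<integral>x. measure (conv x y) A \<partial>\<sigma>) \<partial>q)"
    and nc: "\<not> compact (UNIV :: 'a set)" and nd: "nondegenerate conv e \<sigma>"
  shows "p = q"
proof (rule fin_radon_eqI[OF lc p q])
  fix f :: "'a \<Rightarrow> real" assume f: "f \<in> Cc"
  show "(\<integral>x. f x \<partial>p) = (\<integral>x. f x \<partial>q)"
  proof (rule antisym)
    show "(\<integral>x. f x \<partial>p) \<le> (\<integral>x. f x \<partial>q)" by (rule difference_nonpos[OF p q f inv nc nd])
    \<comment> \<open>Invariance of p - q is also invariance of q - p, so the one-sided maximum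
      principle gives both inequalities.\<close>
    show "(\<integral>x. f x \<partial>q) \<le> (\<integral>x. f x \<partial>p)"
    proof (rule difference_nonpos[OF q p f _ nc nd])
      show "measure q A - measure p A =
        (\<integral>y. (\<integral>x. measure (conv x y) A \<partial>\<sigma>) \<partial>q) - (\<integral>y. (\<integral>x. measure (conv x y) A \<partial>\<sigma>) \<partial>p)"
        if "A \<in> sets borel" for A using inv[OF that] by linarith
    qed
  qed
qed

end

section \<open>Complex measures and the conclusion\<close>

lemma cint_decomp:
  assumes "\<mu> \<in> Mmeas"
  obtains m1 m2 m3 m4 where "cdecomp \<mu> m1 m2 m3 m4"
    "\<And>f. cint \<mu> f = complex_of_real ((\<integral>x. f x \<partial>m1) - (\<integral>x. f x \<partial>m2))
      + \<i> * complex_of_real ((\<integral>x. f x \<partial>m3) - (\<integral>x. f x \<partial>m4))"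
proof -
  \<comment> \<open>The choice made by \<open>SOME\<close> depends only on \<open>\<mu>\<close>, so
    the same four measures serve every \<open>f\<close>.\<close>
  define c where "c = (SOME (m1, m2, m3, m4). cdecomp \<mu> m1 m2 m3 m4)"
  obtain m1 m2 m3 m4 where c: "c = (m1, m2, m3, m4)" by (metis prod_cases4)
  have "\<exists>x. case x of (m1, m2, m3, m4) \<Rightarrow> cdecomp \<mu> m1 m2 m3 m4"
    using assms by (auto simp: Mmeas_def)
  then have "case c of (m1, m2, m3, m4) \<Rightarrow> cdecomp \<mu> m1 m2 m3 m4"
    unfolding c_def by (rule someI_ex)
  then have "cdecomp \<mu> m1 m2 m3 m4" using c by simp
  moreover have "cint \<mu> f = complex_of_real ((\<integral>x. f x \<partial>m1) - (\<integral>x. f x \<partial>m2))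
      + \<i> * complex_of_real ((\<integral>x. f x \<partial>m3) - (\<integral>x. f x \<partial>m4))" for f
    unfolding cint_def c_def[symmetric] c by simp
  ultimately show ?thesis by (rule that)
qed

lemma complex_decomp_eq_iff:
  fixes a b c d :: real
  shows "complex_of_real a + \<i> * complex_of_real b = complex_of_real c + \<i> * complex_of_real d \<longleftrightarrow> a = c \<and> b = d"
  by (auto simp: complex_eq_iff)

lemma zero_in_Mmeas: "(\<lambda>A. 0) \<in> Mmeas"
proof -
  have "fin_radon (null_measure borel :: 'a::topological_space measure)"
    unfolding fin_radon_def radon_def
    by (auto intro!: finite_measureI INF_eqI SUP_eqI antisym INF_lower2[of UNIV] SUP_least)
  then have "cdecomp (\<lambda>A :: 'a set. 0) (null_measure borel) (null_measure borel) (null_measure borel) (null_measure borel)"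
    by (simp add: cdecomp_def)
  then show ?thesis unfolding Mmeas_def by blast
qed

theorem theorem4p16:
  fixes conv :: "'a::t2_space \<Rightarrow> 'a \<Rightarrow> 'a measure" and e :: 'a and iv :: "'a \<Rightarrow> 'a"
    and m \<sigma> :: "'a measure"
  assumes "hypergroup conv e iv"
    and "\<not> compact (UNIV :: 'a set)"
    and "left_haar conv m"
    and "prob_space \<sigma>" and "fin_radon \<sigma>"
    and "nondegenerate conv e \<sigma>"
  shows "H_sigma conv \<sigma> = {\<lambda>A. 0}"
proof (intro equalityI subsetI)
  interpret hypergroup_walk conv e iv \<sigma>
    by (intro hypergroup_walk.intro hypergroup_space.intro hypergroup_walk_axioms.intro) (fact assms)+
  fix \<mu> assume "\<mu> \<in> H_sigma conv \<sigma>"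
  then have \<mu>: "\<mu> \<in> Mmeas" and fix\<mu>: "conv_pm conv \<sigma> \<mu> = \<mu>" by (auto simp: H_sigma_def)
  obtain m1 m2 m3 m4 where dec: "cdecomp \<mu> m1 m2 m3 m4"
    and cint: "\<And>f. cint \<mu> f = complex_of_real ((\<integral>x. f x \<partial>m1) - (\<integral>x. f x \<partial>m2))
      + \<i> * complex_of_real ((\<integral>x. f x \<partial>m3) - (\<integral>x. f x \<partial>m4))"
    using cint_decomp[OF \<mu>] by metis
  have rad: "fin_radon m1" "fin_radon m2" "fin_radon m3" "fin_radon m4"
    and val: "\<And>A. \<mu> A = (if A \<in> sets borel
            then complex_of_real (measure m1 A - measure m2 A)
                 + \<i> * complex_of_real (measure m3 A - measure m4 A) else 0)"
    using dec by (auto simp: cdecomp_def)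
  \<comment> \<open>Convolving with \<open>\<sigma>\<close> integrates a real function, so real and
    imaginary parts of the fixed-point equation separate into invariance of m1 - m2 and of m3 -
    m4.\<close>
  have "measure m1 A - measure m2 A = (\<integral>y. (\<integral>x. measure (conv x y) A \<partial>\<sigma>) \<partial>m1) - (\<integral>y. (\<integral>x. measure (conv x y) A \<partial>\<sigma>) \<partial>m2)
    \<and> measure m3 A - measure m4 A = (\<integral>y. (\<integral>x. measure (conv x y) A \<partial>\<sigma>) \<partial>m3) - (\<integral>y. (\<integral>x. measure (conv x y) A \<partial>\<sigma>) \<partial>m4)"
    if A: "A \<in> sets borel" for A
  proof -
    have "\<mu> A = cint \<mu> (\<lambda>y. \<integral>x. measure (conv x y) A \<partial>\<sigma>)"
      using fun_cong[OF fix\<mu>, of A] A by (simp add: conv_pm_def)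
    then show ?thesis unfolding cint val using A complex_decomp_eq_iff by (metis (no_types, lifting))
  qed
  then have "m1 = m2" "m3 = m4"
    using assms(2,6) rad by (auto intro!: harmonic_difference_zero)
  then show "\<mu> \<in> {\<lambda>A. 0}" using val by auto
next
  fix \<mu> :: "'a set \<Rightarrow> complex" assume "\<mu> \<in> {\<lambda>A. 0}"
  then have \<mu>: "\<mu> = (\<lambda>A. 0)" by simp
  have M: "\<mu> \<in> Mmeas" unfolding \<mu> by (rule zero_in_Mmeas)
  \<comment> \<open>The decomposition chosen for the zero measure may consist of nonzero measures;
    what matters is that they cancel in pairs.\<close>
  obtain m1 m2 m3 m4 where dec: "cdecomp \<mu> m1 m2 m3 m4"
    and cint: "\<And>f. cint \<mu> f = complex_of_real ((\<integral>x. f x \<partial>m1) - (\<integral>x. f x \<partial>m2))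
      + \<i> * complex_of_real ((\<integral>x. f x \<partial>m3) - (\<integral>x. f x \<partial>m4))"
    using cint_decomp[OF M] by metis
  have rad: "fin_radon m1" "fin_radon m2" "fin_radon m3" "fin_radon m4"
    and val: "\<And>A. A \<in> sets borel \<Longrightarrow> complex_of_real (measure m1 A - measure m2 A)
                 + \<i> * complex_of_real (measure m3 A - measure m4 A) = 0"
    using dec unfolding cdecomp_def \<mu> by metis+
  have eq: "measure m1 A = measure m2 A \<and> measure m3 A = measure m4 A" if "A \<in> sets borel" for A
    using val[OF that] by (simp add: complex_eq_iff)
  have "m1 = m2" "m3 = m4"
    using eq rad[THEN fin_radonD(1)] rad[THEN fin_radonD(3)]
    by (auto intro!: measure_eqI simp: finite_measure.emeasure_eq_measure)
  then have "cint \<mu> f = 0" for f using cint by simp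
  then have "conv_pm conv \<sigma> \<mu> = \<mu>" by (auto simp: conv_pm_def \<mu>)
  with M show "\<mu> \<in> H_sigma conv \<sigma>" by (simp add: H_sigma_def)
qed

end
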